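(* Consider the state-space model $x_{k+1}=f_k(x_k)+q_k$, $q_k\sim\mathcal N(0,Q_k)$ $(k=1,\dots,K-1)$, $y_k=h_k(x_k)+r_k$, $r_k\sim\mathcal N(0,R_k)$ $(k=1,\dots,K)$, $x_1\sim\mathcal N(\hat x_{1\mid 0},\hat P_{1\mid 0})$, with measurements $y_{1:K}$. Let $\hat x^{(i)}_{1:K}$ be the current estimate of the state means and $\hat P^{(i)}_{1:K}$ the current covariance matrices, and let $L^{(i)}_{\mathrm{IPLS}}$ be the cost function $$L^{(i)}_{\mathrm{IPLS}}(x_{1:K})=\tfrac12\Big((x_1-\hat x_{1\mid0})^\top\hat P_{1\mid0}^{-1}(x_1-\hat x_{1\mid0})+\sum_{k=1}^{K-1}(x_{k+1}-\bar x_k(x_k))^\top(Q_k+\Omega^{(i)}_k)^{-1}(x_{k+1}-\bar x_k(x_k))+\sum_{k=1}^{K}(y_k-\bar y_k(x_k))^\top(R_k+\Gamma^{(i)}_k)^{-1}(y_k-\bar y_k(x_k))\Big),$$ where $\bar x_k(\cdot),\bar y_k(\cdot)$ are the SLR expectations with covariance $\hat P^{(i)}_k$, and $\Omega^{(i)}_k,\Gamma^{(i)}_k$ are the SLR error covariances computed at $(\hat x^{(i)}_k,\hat P^{(i)}_k)$ and held fixed (see context). Then the output of one Gauss--Newton iteration for minimising $L^{(i)}_{\mathrm{IPLS}}$, started at $\hat x^{(i)}_{1:K}$, equals the sequence of smoothed means produced by Rauch--Tung--Striebel (RTS) smoothing of the state-space model linearised with SLR around $\hat x^{(i)}_{1:K},\hat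 P^{(i)}_{1:K}$, that is, by one iteration of the IPLS.
   Context: States $x_k\in\mathbb R^{d_x}$, measurements $y_k\in\mathbb R^{d_y}$, $f_k:\mathbb R^{d_x}\to\mathbb R^{d_x}$, $h_k:\mathbb R^{d_x}\to\mathbb R^{d_y}$; noises are independent of each other and of $x_1$; $x_{1:K}=(x_1,\dots,x_K)$ is identified with the stacked vector. The matrices $\hat P_{1\mid0}$, $\hat P^{(i)}_k$, $Q_k+\Omega^{(i)}_k$, $R_k+\Gamma^{(i)}_k$ are symmetric positive definite, and all Gaussian moments below are finite (at every point $x$). Statistical linear regression (SLR). For $x\in\mathbb R^{d_x}$, let $p(\xi)=\mathcal N(\xi;x,\hat P^{(i)}_k)$ and define $\bar x_k(x)=\int f_k(\xi)p(\xi)\,d\xi$, $\Psi_{f_k}(x)=\int(\xi-x)(f_k(\xi)-\bar x_k(x))^\top p(\xi)\,d\xi$, $\Phi_{f_k}(x)=\int(f_k(\xi)-\bar x_k(x))(f_k(\xi)-\bar x_k(x))^\top p(\xi)\,d\xi$, and $F_k^{(i)}(x)=\Psi_{f_k}(x)^\top(\hat P^{(i)}_k)^{-1}$, $b_k(x)=\bar x_k(x)-F_k^{(i)}(x)\,x$, $\Omega_k(x)=\Phi_{f_k}(x)-F_k^{(i)}(x)\hat P^{(i)}_kF_k^{(i)}(x)^\top$. Analogously, with $h_k$ in place of $f_k$, define $\bar y_k(x)$, $H_k^{(i)}(x)$, $c_k(x)$, $\Gamma_k(x)$ in place of $\bar x_k(x)$, $F_k^{(i)}(x)$, $b_k(x)$,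 $\Omega_k(x)$. Put $\Omega^{(i)}_k=\Omega_k(\hat x^{(i)}_k)$ and $\Gamma^{(i)}_k=\Gamma_k(\hat x^{(i)}_k)$; these do not depend on the optimisation variable $x_{1:K}$. One Gauss--Newton (GN) iteration. Write $L^{(i)}_{\mathrm{IPLS}}=\frac12\|\rho^{(i)}\|_2^2$ with $\rho^{(i)}(x_{1:K})=\Sigma^{-T/2}z(x_{1:K})$, where $z(x_{1:K})$ stacks $x_1-\hat x_{1\mid0}$, $x_{k+1}-\bar x_k(x_k)$ $(k=1,\dots,K-1)$, $y_k-\bar y_k(x_k)$ $(k=1,\dots,K)$, where $\Sigma^{-1}=\mathrm{diag}(\hat P_{1\mid0}^{-1},(Q_1+\Omega^{(i)}_1)^{-1},\dots,(Q_{K-1}+\Omega^{(i)}_{K-1})^{-1},(R_1+\Gamma^{(i)}_1)^{-1},\dots,(R_K+\Gamma^{(i)}_K)^{-1})$ and $\Sigma^{-1/2}\Sigma^{-T/2}=\Sigma^{-1}$, $\Sigma^{-T/2}=(\Sigma^{-1/2})^\top$. The GN iterate is the minimiser over $x_{1:K}$ of $\frac12\|\rho^{(i)}(\hat x^{(i)}_{1:K})+J_{\rho^{(i)}}(\hat x^{(i)}_{1:K})(x_{1:K}-\hat x^{(i)}_{1:K})\|_2^2$, with $J$ denoting the Jacobian. One IPLS (iterated posterior linearisation smoother) iteration. Replace the model by the affine Gaussian model $x_{k+1}=F_kx_k+b_k+\omega_k+q_k$, $\omega_k\sim\mathcal N(0,\Omega^{(i)}_k)$, $y_k=H_kx_k+c_k+\gamma_k+r_k$,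 $\gamma_k\sim\mathcal N(0,\Gamma^{(i)}_k)$, with $F_k=F_k^{(i)}(\hat x^{(i)}_k)$, $b_k=b_k(\hat x^{(i)}_k)$, $H_k=H_k^{(i)}(\hat x^{(i)}_k)$, $c_k=c_k(\hat x^{(i)}_k)$, the same prior on $x_1$, and all noises mutually independent, white and independent of $x_1$. Then apply the RTS smoother, which for an affine Gaussian model computes the exact marginal posterior distributions of each $x_k$ given $y_{1:K}$; the smoothed means are the posterior means $\mathbb E[x_k\mid y_{1:K}]$ in this affine model. *)

theory Defs
  imports "HOL-Probability.Probability"
begin

text \<open>
  Time indices are natural numbers starting at 1.  A sequence over times \<open>1..K\<close> is a function on
  \<open>nat\<close> of which only the values at \<open>{1..K}\<close> (or \<open>{1..<K}\<close> for the dynamics) are used.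
  In \<open>real^'c^'r\<close> the rows are indexed by \<open>'r\<close> and the columns by \<open>'c\<close>.
\<close>

definition psd :: "real^'n^'n \<Rightarrow> bool" where
  "psd P \<longleftrightarrow> transpose P = P \<and> (\<forall>v. 0 \<le> v \<bullet> (P *v v))"

definition spd :: "real^'n^'n \<Rightarrow> bool" where
  "spd P \<longleftrightarrow> transpose P = P \<and> (\<forall>v. v \<noteq> 0 \<longrightarrow> 0 < v \<bullet> (P *v v))"

definition outer :: "real^'a \<Rightarrow> real^'b \<Rightarrow> real^'b^'a" where
  "outer u v = (\<chi> i j. u $ i * v $ j)"

definition gauss_density :: "real^'n \<Rightarrow> real^'n^'n \<Rightarrow> real^'n \<Rightarrow> real" where
  "gauss_density m P \<xi> =
     exp (- (1/2) * ((\<xi> - m) \<bullet> (matrix_inv P *v (\<xi> - m)))) / sqrt ((2 * pi) ^ CARD('n) * det P)"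


section \<open>Statistical linear regression\<close>

definition slr_mean :: "(real^'n \<Rightarrow> real^'b) \<Rightarrow> real^'n^'n \<Rightarrow> real^'n \<Rightarrow> real^'b" where
  "slr_mean g P x = (\<integral>\<xi>. gauss_density x P \<xi> *\<^sub>R g \<xi> \<partial>lborel)"

definition slr_Psi :: "(real^'n \<Rightarrow> real^'b) \<Rightarrow> real^'n^'n \<Rightarrow> real^'n \<Rightarrow> real^'b^'n" where
  "slr_Psi g P x =
     (\<integral>\<xi>. gauss_density x P \<xi> *\<^sub>R outer (\<xi> - x) (g \<xi> - slr_mean g P x) \<partial>lborel)"

definition slr_Phi :: "(real^'n \<Rightarrow> real^'b) \<Rightarrow> real^'n^'n \<Rightarrow> real^'n \<Rightarrow> real^'b^'b" where
  "slr_Phi g P x =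
     (\<integral>\<xi>. gauss_density x P \<xi> *\<^sub>R outer (g \<xi> - slr_mean g P x) (g \<xi> - slr_mean g P x) \<partial>lborel)"

definition slr_moments_finite :: "(real^'n \<Rightarrow> real^'b) \<Rightarrow> real^'n^'n \<Rightarrow> bool" where
  "slr_moments_finite g P \<longleftrightarrow> (\<forall>x.
     integrable lborel (\<lambda>\<xi>. gauss_density x P \<xi> *\<^sub>R g \<xi>) \<and>
     integrable lborel (\<lambda>\<xi>. gauss_density x P \<xi> *\<^sub>R outer (\<xi> - x) (g \<xi> - slr_mean g P x)) \<and>
     integrable lborel (\<lambda>\<xi>. gauss_density x P \<xi> *\<^sub>R
       outer (g \<xi> - slr_mean g P x) (g \<xi> - slr_mean g P x)))"

definition slr_slope :: "(real^'n \<Rightarrow> real^'b) \<Rightarrow> real^'n^'n \<Rightarrow> real^'n \<Rightarrow> real^'n^'b" where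
  "slr_slope g P x = transpose (slr_Psi g P x) ** matrix_inv P"

definition slr_offset :: "(real^'n \<Rightarrow> real^'b) \<Rightarrow> real^'n^'n \<Rightarrow> real^'n \<Rightarrow> real^'b" where
  "slr_offset g P x = slr_mean g P x - slr_slope g P x *v x"

definition slr_err :: "(real^'n \<Rightarrow> real^'b) \<Rightarrow> real^'n^'n \<Rightarrow> real^'n \<Rightarrow> real^'b^'b" where
  "slr_err g P x = slr_Phi g P x - slr_slope g P x ** P ** transpose (slr_slope g P x)"


section \<open>The state-space model and the IPLS cost\<close>

record ('n::finite, 'm::finite) ssm =
  dyn :: "nat \<Rightarrow> real^'n \<Rightarrow> real^'n"
  obs :: "nat \<Rightarrow> real^'n \<Rightarrow> real^'m"
  Qcov :: "nat \<Rightarrow> real^'n^'n"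
  Rcov :: "nat \<Rightarrow> real^'m^'m"
  prior_mean :: "real^'n"
  prior_cov :: "real^'n^'n"

definition Omega_at :: "('n::finite, 'm::finite) ssm \<Rightarrow> (nat \<Rightarrow> real^'n) \<Rightarrow> (nat \<Rightarrow> real^'n^'n) \<Rightarrow>
    nat \<Rightarrow> real^'n^'n" where
  "Omega_at md xh P k = slr_err (dyn md k) (P k) (xh k)"

definition Gamma_at :: "('n::finite, 'm::finite) ssm \<Rightarrow> (nat \<Rightarrow> real^'n) \<Rightarrow> (nat \<Rightarrow> real^'n^'n) \<Rightarrow>
    nat \<Rightarrow> real^'m^'m" where
  "Gamma_at md xh P k = slr_err (obs md k) (P k) (xh k)"

definition L_IPLS :: "('n::finite, 'm::finite) ssm \<Rightarrow> nat \<Rightarrow> (nat \<Rightarrow> real^'n) \<Rightarrow>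
    (nat \<Rightarrow> real^'n^'n) \<Rightarrow> (nat \<Rightarrow> real^'m) \<Rightarrow> (nat \<Rightarrow> real^'n) \<Rightarrow> real" where
  "L_IPLS md K xh P y x = 1/2 *
     ((x 1 - prior_mean md) \<bullet> (matrix_inv (prior_cov md) *v (x 1 - prior_mean md))
      + (\<Sum>k\<in>{1..<K}.
           (x (Suc k) - slr_mean (dyn md k) (P k) (x k)) \<bullet>
           (matrix_inv (Qcov md k + Omega_at md xh P k) *v
             (x (Suc k) - slr_mean (dyn md k) (P k) (x k))))
      + (\<Sum>k\<in>{1..K}.
           (y k - slr_mean (obs md k) (P k) (x k)) \<bullet>
           (matrix_inv (Rcov md k + Gamma_at md xh P k) *v
             (y k - slr_mean (obs md k) (P k) (x k)))))"


section \<open>One Gauss--Newton iteration\<close>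

text \<open>
  The scalar coordinates of the stacked residual are indexed by \<open>res_index K\<close>.  Matrices and vectors
  on the residual space are functions on this finite index set, because its size varies with \<open>K\<close>;
  likewise the scalar coordinates of the stacked state are indexed by \<open>{1..K} \<times> UNIV\<close>.
\<close>

datatype ('n, 'm) ridx = PriorRow 'n | DynRow nat 'n | ObsRow nat 'm

definition res_index :: "nat \<Rightarrow> ('n::finite, 'm::finite) ridx set" where
  "res_index K = range PriorRow
     \<union> (\<lambda>(k, i). DynRow k i) ` ({1..<K} \<times> UNIV)
     \<union> (\<lambda>(k, i). ObsRow k i) ` ({1..K} \<times> UNIV)"

fun stacked_z :: "('n::finite, 'm::finite) ssm \<Rightarrow> (nat \<Rightarrow> real^'n^'n) \<Rightarrow> (nat \<Rightarrow> real^'m) \<Rightarrow>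
    (nat \<Rightarrow> real^'n) \<Rightarrow> ('n, 'm) ridx \<Rightarrow> real" where
  "stacked_z md P y x (PriorRow i) = (x 1 - prior_mean md) $ i"
| "stacked_z md P y x (DynRow k i) = (x (Suc k) - slr_mean (dyn md k) (P k) (x k)) $ i"
| "stacked_z md P y x (ObsRow k i) = (y k - slr_mean (obs md k) (P k) (x k)) $ i"

fun Sigma_inv :: "('n::finite, 'm::finite) ssm \<Rightarrow> (nat \<Rightarrow> real^'n) \<Rightarrow> (nat \<Rightarrow> real^'n^'n) \<Rightarrow>
    ('n, 'm) ridx \<Rightarrow> ('n, 'm) ridx \<Rightarrow> real" where
  "Sigma_inv md xh P (PriorRow i) (PriorRow j) = matrix_inv (prior_cov md) $ i $ j"
| "Sigma_inv md xh P (DynRow k i) (DynRow l j) =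
     (if k = l then matrix_inv (Qcov md k + Omega_at md xh P k) $ i $ j else 0)"
| "Sigma_inv md xh P (ObsRow k i) (ObsRow l j) =
     (if k = l then matrix_inv (Rcov md k + Gamma_at md xh P k) $ i $ j else 0)"
| "Sigma_inv md xh P _ _ = 0"

text \<open>
  \<open>S\<close> is a choice of \<open>\<Sigma>\<^bsup>-1/2\<^esup>\<close>; it is not required to be symmetric, triangular or block diagonal.
\<close>

definition is_Sigma_inv_sqrt :: "('n::finite, 'm::finite) ssm \<Rightarrow> nat \<Rightarrow> (nat \<Rightarrow> real^'n) \<Rightarrow>
    (nat \<Rightarrow> real^'n^'n) \<Rightarrow> (('n, 'm) ridx \<Rightarrow> ('n, 'm) ridx \<Rightarrow> real) \<Rightarrow> bool" where
  "is_Sigma_inv_sqrt md K xh P S \<longleftrightarrow>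
     (\<forall>a\<in>res_index K. \<forall>b\<in>res_index K.
        (\<Sum>c\<in>res_index K. S a c * S b c) = Sigma_inv md xh P a b)"

text \<open>\<open>\<rho> = \<Sigma>\<^bsup>-T/2\<^esup> z\<close>, with \<open>\<Sigma>\<^bsup>-T/2\<^esup>\<close> the transpose of \<open>S\<close>.\<close>

definition residual :: "('n::finite, 'm::finite) ssm \<Rightarrow> nat \<Rightarrow> (nat \<Rightarrow> real^'n^'n) \<Rightarrow>
    (nat \<Rightarrow> real^'m) \<Rightarrow> (('n, 'm) ridx \<Rightarrow> ('n, 'm) ridx \<Rightarrow> real) \<Rightarrow>
    (nat \<Rightarrow> real^'n) \<Rightarrow> ('n, 'm) ridx \<Rightarrow> real" where
  "residual md K P y S x a = (\<Sum>b\<in>res_index K. S b a * stacked_z md P y x b)"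

definition sq_norm_on :: "'i set \<Rightarrow> ('i \<Rightarrow> real) \<Rightarrow> real" where
  "sq_norm_on I v = (\<Sum>a\<in>I. (v a)\<^sup>2)"

text \<open>Entry \<open>(a, (j, l))\<close> of the Jacobian: the partial derivative of \<open>r a\<close> in coordinate \<open>l\<close> of \<open>x j\<close>.\<close>

definition jacobian_entry :: "((nat \<Rightarrow> real^'n) \<Rightarrow> 'i \<Rightarrow> real) \<Rightarrow> (nat \<Rightarrow> real^'n) \<Rightarrow>
    'i \<Rightarrow> nat \<times> 'n \<Rightarrow> real" where
  "jacobian_entry r x a = (\<lambda>(j, l). deriv (\<lambda>t. r (x(j := x j + t *\<^sub>R axis l 1)) a) 0)"

definition gn_objective :: "('n::finite, 'm::finite) ssm \<Rightarrow> nat \<Rightarrow> (nat \<Rightarrow> real^'n) \<Rightarrow>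
    (nat \<Rightarrow> real^'n^'n) \<Rightarrow> (nat \<Rightarrow> real^'m) \<Rightarrow> (('n, 'm) ridx \<Rightarrow> ('n, 'm) ridx \<Rightarrow> real) \<Rightarrow>
    (nat \<Rightarrow> real^'n) \<Rightarrow> real" where
  "gn_objective md K xh P y S x = 1/2 * sq_norm_on (res_index K)
     (\<lambda>a. residual md K P y S xh a +
        (\<Sum>(j, l)\<in>{1..K} \<times> UNIV.
           jacobian_entry (residual md K P y S) xh a (j, l) * (x j - xh j) $ l))"

definition is_gn_iterate :: "('n::finite, 'm::finite) ssm \<Rightarrow> nat \<Rightarrow> (nat \<Rightarrow> real^'n) \<Rightarrow>
    (nat \<Rightarrow> real^'n^'n) \<Rightarrow> (nat \<Rightarrow> real^'m) \<Rightarrow> (('n, 'm) ridx \<Rightarrow> ('n, 'm) ridx \<Rightarrow> real) \<Rightarrow>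
    (nat \<Rightarrow> real^'n) \<Rightarrow> bool" where
  "is_gn_iterate md K xh P y S x \<longleftrightarrow>
     (\<forall>x'. gn_objective md K xh P y S x \<le> gn_objective md K xh P y S x')"


section \<open>Affine Gaussian models and the RTS smoother\<close>

record ('n::finite, 'm::finite) affine_model =
  aF :: "nat \<Rightarrow> real^'n^'n"
  ab :: "nat \<Rightarrow> real^'n"
  aOmega :: "nat \<Rightarrow> real^'n^'n"
  aQ :: "nat \<Rightarrow> real^'n^'n"
  aH :: "nat \<Rightarrow> real^'n^'m"
  ac :: "nat \<Rightarrow> real^'m"
  aGamma :: "nat \<Rightarrow> real^'m^'m"
  aR :: "nat \<Rightarrow> real^'m^'m"
  am :: "real^'n"
  aP :: "real^'n^'n"

definition slr_affine_model :: "('n::finite, 'm::finite) ssm \<Rightarrow> (nat \<Rightarrow> real^'n) \<Rightarrow>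
    (nat \<Rightarrow> real^'n^'n) \<Rightarrow> ('n, 'm) affine_model" where
  "slr_affine_model md xh P =
     \<lparr> aF = (\<lambda>k. slr_slope (dyn md k) (P k) (xh k)),
       ab = (\<lambda>k. slr_offset (dyn md k) (P k) (xh k)),
       aOmega = Omega_at md xh P,
       aQ = Qcov md,
       aH = (\<lambda>k. slr_slope (obs md k) (P k) (xh k)),
       ac = (\<lambda>k. slr_offset (obs md k) (P k) (xh k)),
       aGamma = Gamma_at md xh P,
       aR = Rcov md,
       am = prior_mean md,
       aP = prior_cov md \<rparr>"

definition kf_predict :: "('n::finite, 'm::finite) affine_model \<Rightarrow> nat \<Rightarrow>
    (real^'n) \<times> (real^'n^'n) \<Rightarrow> (real^'n) \<times> (real^'n^'n)" where
  "kf_predict A k = (\<lambda>(m, P).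
     (aF A k *v m + ab A k,
      aF A k ** P ** transpose (aF A k) + (aQ A k + aOmega A k)))"

definition kf_update :: "('n::finite, 'm::finite) affine_model \<Rightarrow> (nat \<Rightarrow> real^'m) \<Rightarrow> nat \<Rightarrow>
    (real^'n) \<times> (real^'n^'n) \<Rightarrow> (real^'n) \<times> (real^'n^'n)" where
  "kf_update A y k = (\<lambda>(m, P).
     let S = aH A k ** P ** transpose (aH A k) + (aR A k + aGamma A k);
         G = P ** transpose (aH A k) ** matrix_inv S
     in (m + G *v (y k - (aH A k *v m + ac A k)), P - G ** S ** transpose G))"

text \<open>\<open>kf_pred A y k\<close>: mean and covariance of \<open>x\<^bsub>k+1\<^esub>\<close> given \<open>y\<^bsub>1:k\<^esub>\<close>.\<close>

primrec kf_pred :: "('n::finite, 'm::finite) affine_model \<Rightarrow> (nat \<Rightarrow> real^'m) \<Rightarrow> nat \<Rightarrow>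
    (real^'n) \<times> (real^'n^'n)" where
  "kf_pred A y 0 = (am A, aP A)"
| "kf_pred A y (Suc k) = kf_predict A (Suc k) (kf_update A y (Suc k) (kf_pred A y k))"

text \<open>\<open>kf_filt A y k\<close>, for \<open>k \<ge> 1\<close>: mean and covariance of \<open>x\<^bsub>k\<^esub>\<close> given \<open>y\<^bsub>1:k\<^esub>\<close>.\<close>

definition kf_filt :: "('n::finite, 'm::finite) affine_model \<Rightarrow> (nat \<Rightarrow> real^'m) \<Rightarrow> nat \<Rightarrow>
    (real^'n) \<times> (real^'n^'n)" where
  "kf_filt A y k = kf_update A y k (kf_pred A y (k - 1))"

definition rts_step :: "('n::finite, 'm::finite) affine_model \<Rightarrow> (nat \<Rightarrow> real^'m) \<Rightarrow> nat \<Rightarrow>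
    (real^'n) \<times> (real^'n^'n) \<Rightarrow> (real^'n) \<times> (real^'n^'n)" where
  "rts_step A y k = (\<lambda>(ms, Ps).
     let (m, P) = kf_filt A y k;
         (m', P') = kf_pred A y k;
         G = P ** transpose (aF A k) ** matrix_inv P'
     in (m + G *v (ms - m'), P + G ** (Ps - P') ** transpose G))"

primrec rts_back :: "('n::finite, 'm::finite) affine_model \<Rightarrow> (nat \<Rightarrow> real^'m) \<Rightarrow> nat \<Rightarrow> nat \<Rightarrow>
    (real^'n) \<times> (real^'n^'n)" where
  "rts_back A y K 0 = kf_filt A y K"
| "rts_back A y K (Suc j) = rts_step A y (K - Suc j) (rts_back A y K j)"

definition rts_mean :: "('n::finite, 'm::finite) affine_model \<Rightarrow> nat \<Rightarrow> (nat \<Rightarrow> real^'m) \<Rightarrow> nat \<Rightarrow>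
    real^'n" where
  "rts_mean A K y k = fst (rts_back A y K (K - k))"


section \<open>Posterior means in an affine Gaussian model\<close>

text \<open>Gaussian random vectors, with possibly singular covariance.\<close>

definition gaussian_rv :: "'w measure \<Rightarrow> ('w \<Rightarrow> real^'n) \<Rightarrow> real^'n \<Rightarrow> real^'n^'n \<Rightarrow> bool" where
  "gaussian_rv M X m P \<longleftrightarrow> X \<in> borel_measurable M \<and> psd P \<and>
     (\<forall>u. distr M borel (\<lambda>w. u \<bullet> X w) =
        (if u \<bullet> (P *v u) = 0 then return borel (u \<bullet> m)
         else density lborel (\<lambda>t. ennreal (normal_density (u \<bullet> m) (sqrt (u \<bullet> (P *v u))) t))))"

datatype source = Initial | DynLin nat | DynNoise nat | ObsLin nat | ObsNoise nat

text \<open>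
  \<open>X\<close> and \<open>Y\<close> are states and measurements of the affine model, driven by \<open>om k\<close> (linearisation error)
  and \<open>q k\<close> (process noise) in the dynamics and by \<open>ga k\<close> and \<open>r k\<close> in the measurements.
\<close>

definition realises :: "('n::finite, 'm::finite) affine_model \<Rightarrow> nat \<Rightarrow> 'w measure \<Rightarrow>
    (nat \<Rightarrow> 'w \<Rightarrow> real^'n) \<Rightarrow> (nat \<Rightarrow> 'w \<Rightarrow> real^'m) \<Rightarrow>
    (nat \<Rightarrow> 'w \<Rightarrow> real^'n) \<Rightarrow> (nat \<Rightarrow> 'w \<Rightarrow> real^'n) \<Rightarrow>
    (nat \<Rightarrow> 'w \<Rightarrow> real^'m) \<Rightarrow> (nat \<Rightarrow> 'w \<Rightarrow> real^'m) \<Rightarrow> bool" where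
  "realises A K M X Y om q ga r \<longleftrightarrow>
     prob_space M \<and>
     gaussian_rv M (X 1) (am A) (aP A) \<and>
     (\<forall>k\<in>{1..<K}. gaussian_rv M (om k) 0 (aOmega A k) \<and> gaussian_rv M (q k) 0 (aQ A k)) \<and>
     (\<forall>k\<in>{1..K}. gaussian_rv M (ga k) 0 (aGamma A k) \<and> gaussian_rv M (r k) 0 (aR A k)) \<and>
     prob_space.indep_sets M
       (\<lambda>s. case s of
            Initial \<Rightarrow> sets (vimage_algebra (space M) (X 1) borel)
          | DynLin k \<Rightarrow> sets (vimage_algebra (space M) (om k) borel)
          | DynNoise k \<Rightarrow> sets (vimage_algebra (space M) (q k) borel)
          | ObsLin k \<Rightarrow> sets (vimage_algebra (space M) (ga k) borel)
          | ObsNoise k \<Rightarrow> sets (vimage_algebra (space M) (r k) borel))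
       ({Initial} \<union> DynLin ` {1..<K} \<union> DynNoise ` {1..<K} \<union> ObsLin ` {1..K} \<union> ObsNoise ` {1..K}) \<and>
     (\<forall>k\<in>{1..<K}. \<forall>w\<in>space M. X (Suc k) w = aF A k *v X k w + ab A k + om k w + q k w) \<and>
     (\<forall>k\<in>{1..K}. \<forall>w\<in>space M. Y k w = aH A k *v X k w + ac A k + ga k w + r k w)"

definition meas_algebra :: "nat \<Rightarrow> 'w measure \<Rightarrow> (nat \<Rightarrow> 'w \<Rightarrow> real^'m) \<Rightarrow> 'w measure" where
  "meas_algebra K M Y =
     vimage_algebra (space M) (\<lambda>w. \<lambda>k\<in>{1..K}. Y k w) (PiM {1..K} (\<lambda>_. borel))"

text \<open>
  \<open>\<phi> y\<close> is the posterior mean of \<open>Xk\<close> given \<open>Y\<^bsub>1:K\<^esub> = y\<^bsub>1:K\<^esub>\<close>.  Conditional expectation determines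
  such a function only up to null sets of the law of \<open>Y\<^bsub>1:K\<^esub>\<close>; continuity makes it unique at every
  point when that law has full support, as it does when the total measurement noise
  covariances are positive definite.
\<close>

definition posterior_mean_fun :: "'w measure \<Rightarrow> ('w \<Rightarrow> real^'n) \<Rightarrow> nat \<Rightarrow> (nat \<Rightarrow> 'w \<Rightarrow> real^'m) \<Rightarrow>
    ((nat \<Rightarrow> real^'m) \<Rightarrow> real^'n) \<Rightarrow> bool" where
  "posterior_mean_fun M Xk K Y \<phi> \<longleftrightarrow>
     (\<forall>y y'. (\<forall>k\<in>{1..K}. y k = y' k) \<longrightarrow> \<phi> y = \<phi> y') \<and>
     continuous_on UNIV \<phi> \<and>
     (\<forall>i. integrable M (\<lambda>w. Xk w $ i) \<and>
        (AE w in M. real_cond_exp M (meas_algebra K M Y) (\<lambda>w. Xk w $ i) w = \<phi> (\<lambda>k. Y k w) $ i))"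

end

theory Submission
  imports Defs
begin

text \<open>
  Gauss--Newton: by Stein's identity the Jacobian of the SLR expectation is the SLR slope, so the
  linearised residual is the residual of the affine model, and the Gauss--Newton objective is half the
  quadratic cost of that model.  Completing the square once per filter update and once per prediction
  writes this cost as a constant plus squares that vanish simultaneously exactly at the RTS means.

  Posterior means: let \<open>D\<close> be a component of the error of the smoothed mean and \<open>U\<close> an affine function
  of the measurements.  Reflecting the states about the smoothed means fixes the measurements and
  preserves the cost.  Since the variance of a linear functional of the noise is dual to the cost,
  \<open>U + s D\<close> and \<open>U - s D\<close> have the same Gaussian law, so \<open>E[sin (s D) cos U] = 0\<close>; letting \<open>s \<rightarrow> 0\<close>
  gives \<open>E[D cos U] = 0\<close>.  Uniqueness of characteristic functions, applied to one measurement coordinate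
  at a time, yields \<open>E[D 1\<^sub>E] = 0\<close> for every event \<open>E\<close> generated by the measurements.  No density is
  needed, so singular noise covariances cause no difficulty.
\<close>

section \<open>Symmetric positive definite matrices\<close>

text \<open>The obstacle is that the joint covariance of states and measurements grows with
  \<open>K\<close> and that the individual noises may be singular; only the totals
  \<open>aQ + aOmega\<close> and \<open>aR + aGamma\<close> are assumed invertible. The joint
  covariance is therefore never formed. Everything is read off the cost, a sum over times: up to a
  constant it is minus twice the log-density of the total noises, and its convex conjugate is the
  variance. Symmetry of the cost about its minimiser then does the work of "the mean of a Gaussian
  is its mode". One identity, \<open>conditioning\<close>, supplies all squares. With the
  measurement matrix it is the filter update. With the transition matrix it is the prediction, and
  the square left over is the backward kernel of \<open>x k\<close> given \<open>x (Suc k)\<close>,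
  whose gain is the RTS gain. Cosines alone suffice as test functions because \<open>U\<close> may
  contain an additive constant, which turns a cosine into a sine.\<close>

lemma inner_matrix_vector:
  fixes A :: "real^'n^'m"
  shows "(A *v x) \<bullet> y = x \<bullet> (transpose A *v y)"
  by (metis dot_lmul_matrix inner_commute transpose_matrix_vector)

lemma inner_transpose_matrix_vector:
  fixes A :: "real^'n^'m"
  shows "(transpose A *v x) \<bullet> y = x \<bullet> (A *v y)"
  by (simp add: inner_matrix_vector transpose_transpose del: transpose_matrix_vector)

lemma matrix_inv_vector_inverse:
  fixes A :: "real^'n^'n"
  assumes "invertible A"
  shows "A *v (matrix_inv A *v x) = x" "matrix_inv A *v (A *v x) = x"
proof -
  have "A ** matrix_inv A = mat 1 \<and> matrix_inv A ** A = mat 1"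
    using assms unfolding invertible_def matrix_inv_def by (rule someI_ex)
  then show "A *v (matrix_inv A *v x) = x" "matrix_inv A *v (A *v x) = x"
    by (simp_all add: matrix_vector_mul_assoc)
qed

lemma spd_invertible:
  assumes "spd P"
  shows "invertible P"
proof -
  have "\<forall>v. P *v v = 0 \<longrightarrow> v = 0"
    using assms unfolding spd_def by (metis inner_zero_right less_irrefl)
  then show ?thesis
    by (metis invertible_left_inverse matrix_left_invertible_ker)
qed

lemmas spd_inverse = matrix_inv_vector_inverse[OF spd_invertible]

lemma spd_inner_commute:
  assumes "spd P"
  shows "(P *v x) \<bullet> y = x \<bullet> (P *v y)"
  using assms by (simp add: spd_def inner_matrix_vector del: transpose_matrix_vector)

lemma spd_inv_inner_commute:
  assumes "spd P"
  shows "(matrix_inv P *v x) \<bullet> y = x \<bullet> (matrix_inv P *v y)"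
  by (metis assms spd_inner_commute spd_inverse(1))

lemma transpose_eqI:
  fixes A :: "real^'n^'n"
  assumes "\<And>x y. (A *v x) \<bullet> y = x \<bullet> (A *v y)"
  shows "transpose A = A"
proof -
  have "x \<bullet> (transpose A *v y - A *v y) = 0" for x y
    using assms[of x y] by (simp add: inner_matrix_vector inner_diff_right del: transpose_matrix_vector)
  then have "transpose A *v y = A *v y" for y
    by (metis inner_eq_zero_iff eq_iff_diff_eq_0)
  then show ?thesis by (simp add: matrix_eq del: transpose_matrix_vector)
qed

lemma spd_matrix_inv:
  assumes "spd P"
  shows "spd (matrix_inv P)"
  unfolding spd_def
proof (intro conjI allI impI)
  show "transpose (matrix_inv P) = matrix_inv P"
    by (rule transpose_eqI) (rule spd_inv_inner_commute[OF assms])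
  fix v :: "real^'a" assume "v \<noteq> 0"
  then have "matrix_inv P *v v \<noteq> 0" by (metis assms spd_inverse(1) matrix_vector_mult_0_right)
  then have "0 < (matrix_inv P *v v) \<bullet> (P *v (matrix_inv P *v v))"
    using assms by (simp add: spd_def)
  then show "0 < v \<bullet> (matrix_inv P *v v)"
    by (simp add: spd_inverse[OF assms] inner_commute)
qed

lemma matrix_inv_eqI:
  fixes A B :: "real^'n^'n"
  assumes "\<And>x. A *v (B *v x) = x"
  shows "matrix_inv A = B"
proof -
  have "A ** B = mat 1"
    using assms by (simp add: matrix_eq matrix_vector_mul_assoc)
  then have i: "invertible A"
    using invertible_right_inverse by blast
  show ?thesis
    unfolding matrix_eq by (metis assms i matrix_inv_vector_inverse(2))
qed

text \<open>Positive definiteness of an updated covariance is obtained through its inverse: the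
  covariance is a difference of matrices, its inverse a sum of visibly nonnegative terms.\<close>

lemma spd_inverseD:
  assumes "spd L" "\<And>x. A *v (L *v x) = x"
  shows "spd A" "matrix_inv A = L"
proof -
  show "matrix_inv A = L" using assms(2) by (rule matrix_inv_eqI)
  have "A = matrix_inv L"
    unfolding matrix_eq by (metis assms spd_inverse(1))
  then show "spd A" using spd_matrix_inv[OF assms(1)] by simp
qed

text \<open>Squared Mahalanobis length: up to a constant, minus twice a centred Gaussian
  log-density. The argument is the covariance, so that the outputs of the filter can be inserted
  directly.\<close>

definition mahal :: "real^'n^'n \<Rightarrow> real^'n \<Rightarrow> real" where
  "mahal P v = v \<bullet> (matrix_inv P *v v)"

lemma mahal_nonneg: "spd P \<Longrightarrow> 0 \<le> mahal P v"
  unfolding mahal_def using spd_matrix_inv[of P]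
  by (metis inner_zero_left less_eq_real_def spd_def)

lemma mahal_eq_0_iff: "spd P \<Longrightarrow> mahal P v = 0 \<longleftrightarrow> v = 0"
  unfolding mahal_def using spd_matrix_inv[of P]
  by (metis inner_zero_left less_irrefl spd_def)

lemma mahal_minus [simp]: "mahal P (- v) = mahal P v"
  by (simp add: mahal_def vec.neg)

lemma spd_innovation:
  fixes H :: "real^'n^'m"
  assumes "spd P" "spd R"
  shows "spd (H ** P ** transpose H + R)"
  unfolding spd_def
proof (intro conjI allI impI)
  have PR: "transpose P = P" "transpose R = R" using assms by (auto simp: spd_def)
  have ta: "transpose (A + B) = transpose A + transpose B" for A B :: "real^'m^'m"
    by (simp add: transpose_def vec_eq_iff)
  show "transpose (H ** P ** transpose H + R) = H ** P ** transpose H + R"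
    by (simp add: ta matrix_transpose_mul PR matrix_mul_assoc)
  fix v :: "real^'m" assume "v \<noteq> 0"
  then have "0 < v \<bullet> (R *v v)" using assms by (simp add: spd_def)
  moreover have "0 \<le> (transpose H *v v) \<bullet> (P *v (transpose H *v v))"
    using assms by (metis inner_zero_left less_eq_real_def spd_def)
  then have "0 \<le> v \<bullet> (H *v (P *v (transpose H *v v)))"
    by (simp only: inner_transpose_matrix_vector)
  ultimately show "0 < v \<bullet> ((H ** P ** transpose H + R) *v v)"
    by (simp add: matrix_vector_mult_add_rdistrib inner_add_right matrix_vector_mul_assoc[symmetric])
qed

text \<open>Bayes' rule in the exponents: for \<open>e\<close> with covariance \<open>P\<close> and
  \<open>v = H e + noise\<close> with noise covariance \<open>R\<close>, the joint density factors
  into the marginal of \<open>v\<close> (covariance \<open>S\<close>) and the conditional of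
  \<open>e\<close> (mean \<open>G v\<close>, covariance \<open>C\<close>).\<close>

lemma conditioning:
  fixes H :: "real^'n^'m"
  assumes P: "spd P" and R: "spd R"
  defines "S \<equiv> H ** P ** transpose H + R"
  defines "G \<equiv> P ** transpose H ** matrix_inv S"
  defines "C \<equiv> P - G ** S ** transpose G"
  shows spd_conditioning: "spd C"
    and mahal_conditioning: "mahal P e + mahal R (v - H *v e) = mahal S v + mahal C (e - G *v v)"
proof -
  note [simp del] = transpose_matrix_vector
  have S: "spd S" unfolding S_def by (rule spd_innovation[OF P R])
  let ?Pi = "matrix_inv P" and ?Ri = "matrix_inv R" and ?Si = "matrix_inv S"
  \<comment> \<open>\<open>L\<close> is the posterior precision, the sum of the prior information
    and the information carried by the measurement.\<close>
  define L where "L = ?Pi + transpose H ** ?Ri ** H"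
  have Sv: "S *v x = H *v (P *v (transpose H *v x)) + R *v x" for x
    by (simp add: S_def matrix_vector_mult_add_rdistrib matrix_vector_mul_assoc[symmetric])
  have Gv: "G *v x = P *v (transpose H *v (?Si *v x))" for x
    by (simp add: G_def matrix_vector_mul_assoc[symmetric])
  have Lv: "L *v x = ?Pi *v x + transpose H *v (?Ri *v (H *v x))" for x
    by (simp add: L_def matrix_vector_mult_add_rdistrib matrix_vector_mul_assoc[symmetric])
  have Gt: "transpose G = ?Si ** H ** P"
    using P spd_matrix_inv[OF S] unfolding G_def
    by (simp add: matrix_transpose_mul spd_def matrix_mul_assoc)
  have Cv: "C *v x = P *v x - P *v (transpose H *v (?Si *v (H *v (P *v x))))" for x
    by (simp add: C_def Gt matrix_vector_mult_diff_rdistrib matrix_vector_mul_assoc[symmetric] Gv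
        spd_inverse[OF S])
  have L: "spd L"
    unfolding spd_def
  proof (intro conjI allI impI)
    show "transpose L = L"
      by (rule transpose_eqI)
        (use spd_matrix_inv[OF P] spd_matrix_inv[OF R] in
          \<open>simp add: Lv inner_add_left inner_add_right inner_matrix_vector transpose_transpose spd_def\<close>)
    fix x :: "real^'n" assume "x \<noteq> 0"
    then have "0 < x \<bullet> (?Pi *v x)" using spd_matrix_inv[OF P] by (simp add: spd_def)
    moreover have "0 \<le> (H *v x) \<bullet> (?Ri *v (H *v x))"
      using mahal_nonneg[OF R] by (simp add: mahal_def)
    ultimately show "0 < x \<bullet> (L *v x)"
      by (simp add: Lv inner_add_right inner_matrix_vector)
  qed
  \<comment> \<open>The Woodbury identity: the covariance form \<open>C\<close> and the information
    form \<open>L\<close> are inverse to each other.\<close>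
  have CL: "C *v (L *v x) = x" for x
  proof -
    define u where "u = ?Ri *v (H *v x)"
    have "H *v (P *v (L *v x)) = S *v u"
      by (simp add: Lv Sv u_def vec.add spd_inverse[OF P] spd_inverse[OF R])
    then have "?Si *v (H *v (P *v (L *v x))) = u" by (simp add: spd_inverse[OF S])
    then show ?thesis
      by (simp add: Cv) (simp add: Lv u_def vec.add spd_inverse[OF P])
  qed
  note C = spd_inverseD[OF L CL]
  show "spd C" by (rule C)
  define t where "t = ?Si *v v"
  have v: "v = S *v t" by (simp add: t_def spd_inverse[OF S])
  define g where "g = G *v v"
  have g: "g = P *v (transpose H *v t)" by (simp add: g_def Gv t_def)
  have Lg: "L *v g = transpose H *v (?Ri *v v)"
    by (simp add: Lv g v Sv vec.add spd_inverse[OF P] spd_inverse[OF R])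
  have Hg: "H *v g = v - R *v t" by (simp add: g v Sv)
  \<comment> \<open>\<open>t \<bullet> v\<close> equals \<open>mahal S v\<close>, so the part of the
    \<open>C\<close>-square that is quadratic in \<open>v\<close> is the \<open>R\<close>-square of
    \<open>v\<close> minus the innovation term. The cross terms and the part quadratic in
    \<open>e\<close> match separately.\<close>
  have gg: "g \<bullet> (L *v g) = v \<bullet> (?Ri *v v) - t \<bullet> v"
  proof -
    have "g \<bullet> (L *v g) = (H *v g) \<bullet> (?Ri *v v)" by (simp add: Lg inner_matrix_vector)
    also have "\<dots> = v \<bullet> (?Ri *v v) - t \<bullet> v"
      by (simp add: Hg inner_diff_left spd_inner_commute[OF R] spd_inverse[OF R])
    finally show ?thesis .
  qed
  have sym: "g \<bullet> (L *v e) = e \<bullet> (L *v g)"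
    by (metis L spd_inner_commute inner_commute)
  have sym2: "(H *v e) \<bullet> (?Ri *v v) = v \<bullet> (?Ri *v (H *v e))"
    by (metis R spd_inv_inner_commute inner_commute)
  have eg: "e \<bullet> (L *v g) = (H *v e) \<bullet> (?Ri *v v)"
    by (simp add: Lg inner_matrix_vector)
  have ee: "e \<bullet> (L *v e) = e \<bullet> (?Pi *v e) + (H *v e) \<bullet> (?Ri *v (H *v e))"
    by (simp add: Lv inner_add_right inner_matrix_vector)
  show "mahal P e + mahal R (v - H *v e) = mahal S v + mahal C (e - G *v v)"
    unfolding mahal_def g_def[symmetric] C(2)
    by (simp add: vec.diff inner_diff_left inner_diff_right gg sym sym2 eg ee t_def[symmetric]
        inner_commute[of t v])
qed

section \<open>Kalman recursions as completion of squares\<close>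

definition affine_cost ::
  "('n::finite, 'm::finite) affine_model \<Rightarrow> nat \<Rightarrow> (nat \<Rightarrow> real^'m) \<Rightarrow> (nat \<Rightarrow> real^'n) \<Rightarrow> real" where
  "affine_cost A K y x =
     mahal (aP A) (x 1 - am A)
     + (\<Sum>k\<in>{1..<K}. mahal (aQ A k + aOmega A k) (x (Suc k) - (aF A k *v x k + ab A k)))
     + (\<Sum>k\<in>{1..K}. mahal (aR A k + aGamma A k) (y k - (aH A k *v x k + ac A k)))"

definition rts_gain ::
  "('n::finite, 'm::finite) affine_model \<Rightarrow> (nat \<Rightarrow> real^'m) \<Rightarrow> nat \<Rightarrow> real^'n^'n" where
  "rts_gain A y k =
     snd (kf_filt A y k) ** transpose (aF A k) ** matrix_inv (snd (kf_pred A y k))"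

text \<open>Residual of the backward recursion: the deviation of \<open>x k\<close> from its
  conditional mean given \<open>x (Suc k)\<close> and the measurements up to
  \<open>k\<close>.\<close>

definition rts_defect :: "('n::finite, 'm::finite) affine_model \<Rightarrow> (nat \<Rightarrow> real^'m) \<Rightarrow>
    (nat \<Rightarrow> real^'n) \<Rightarrow> nat \<Rightarrow> real^'n" where
  "rts_defect A y x k =
     x k - fst (kf_filt A y k) - rts_gain A y k *v (x (Suc k) - fst (kf_pred A y k))"

text \<open>Covariance of that deviation, in the shape of \<open>C\<close> in
  \<open>conditioning\<close>. It differs from the smoothed covariance of \<open>rts_step\<close>,
  which also carries the uncertainty of the next state.\<close>

definition backward_cov ::
  "('n::finite, 'm::finite) affine_model \<Rightarrow> (nat \<Rightarrow> real^'m) \<Rightarrow> nat \<Rightarrow> real^'n^'n" where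
  "backward_cov A y k = snd (kf_filt A y k)
     - rts_gain A y k ** snd (kf_pred A y k) ** transpose (rts_gain A y k)"

lemma kf_filt_Suc: "kf_filt A y (Suc k) = kf_update A y (Suc k) (kf_pred A y k)"
  by (simp add: kf_filt_def)

lemma kf_pred_Suc: "kf_pred A y (Suc k) = kf_predict A (Suc k) (kf_filt A y (Suc k))"
  by (simp add: kf_filt_def)

lemma rts_mean_last: "rts_mean A K y K = fst (kf_filt A y K)"
  by (simp add: rts_mean_def)

lemma rts_mean_step:
  assumes "k < K"
  shows "rts_mean A K y k =
    fst (kf_filt A y k) + rts_gain A y k *v (rts_mean A K y (Suc k) - fst (kf_pred A y k))"
proof -
  have K: "K - k = Suc (K - Suc k)" "K - Suc (K - Suc k) = k" using assms by auto
  show ?thesis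
    unfolding rts_mean_def K(1) rts_back.simps K(2)
    by (simp add: rts_step_def rts_gain_def Let_def case_prod_unfold)
qed

text \<open>The right-hand side is a triangular system: the filter fixes the last state, and each
  vanishing defect then determines \<open>x k\<close> from \<open>x (Suc k)\<close>.\<close>

lemma rts_mean_unique:
  assumes "1 \<le> K"
  shows "(\<forall>k\<in>{1..K}. x k = rts_mean A K y k) \<longleftrightarrow>
    x K = fst (kf_filt A y K) \<and> (\<forall>k\<in>{1..<K}. rts_defect A y x k = 0)"
proof (intro iffI conjI ballI)
  assume *: "\<forall>k\<in>{1..K}. x k = rts_mean A K y k"
  show "x K = fst (kf_filt A y K)" using * assms by (simp add: rts_mean_last)
  fix k assume "k \<in> {1..<K}"
  then show "rts_defect A y x k = 0"
    using * rts_mean_step[of k K A y] by (simp add: rts_defect_def)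
next
  assume *: "x K = fst (kf_filt A y K) \<and> (\<forall>k\<in>{1..<K}. rts_defect A y x k = 0)"
  fix k assume "k \<in> {1..K}"
  then have "k \<le> K" "1 \<le> k" by auto
  then show "x k = rts_mean A K y k"
  proof (induction k rule: inc_induct)
    case base
    then show ?case using * by (simp add: rts_mean_last)
  next
    case (step k)
    then have "rts_defect A y x k = 0" "x (Suc k) = rts_mean A K y (Suc k)" using * by auto
    then show ?case
      using step rts_mean_step[of k K A y] by (simp add: rts_defect_def diff_eq_eq add.commute)
  qed
qed

locale regular_affine_model =
  fixes A :: "('n::finite, 'm::finite) affine_model" and K :: nat
  assumes K: "1 \<le> K"
    and spd_prior: "spd (aP A)"
    and spd_dyn: "\<And>k. k \<in> {1..<K} \<Longrightarrow> spd (aQ A k + aOmega A k)"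
    and spd_obs: "\<And>k. k \<in> {1..K} \<Longrightarrow> spd (aR A k + aGamma A k)"
begin

lemma spd_update:
  assumes "k \<in> {1..K}" "spd (snd p)"
  shows "spd (snd (kf_update A y k p))"
  using spd_conditioning[OF assms(2) spd_obs[OF assms(1)], of "aH A k"]
  by (simp add: kf_update_def Let_def case_prod_unfold)

text \<open>The constant is the innovation cost. It is fixed before \<open>x\<close> because it
  depends on the data only; this is what lets it drop out of minimisation and reflection.\<close>

lemma mahal_update:
  assumes "k \<in> {1..K}" "spd (snd p)"
  obtains c where "\<And>x. mahal (snd p) (x - fst p)
      + mahal (aR A k + aGamma A k) (y k - (aH A k *v x + ac A k))
    = c + mahal (snd (kf_update A y k p)) (x - fst (kf_update A y k p))"
proof
  fix x
  let ?v = "y k - (aH A k *v fst p + ac A k)"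
  have v: "?v - aH A k *v (x - fst p) = y k - (aH A k *v x + ac A k)"
    by (simp add: vec.diff)
  show "mahal (snd p) (x - fst p)
      + mahal (aR A k + aGamma A k) (y k - (aH A k *v x + ac A k))
    = mahal (aH A k ** snd p ** transpose (aH A k) + (aR A k + aGamma A k)) ?v
      + mahal (snd (kf_update A y k p)) (x - fst (kf_update A y k p))"
    using mahal_conditioning[OF assms(2) spd_obs[OF assms(1)], of "x - fst p" ?v "aH A k"]
    unfolding v kf_update_def Let_def case_prod_unfold fst_conv snd_conv
      diff_diff_eq[of x "fst p"] .
qed

lemma spd_predict:
  assumes "k \<in> {1..<K}" "spd (snd p)"
  shows "spd (snd (kf_predict A k p))"
  using spd_innovation[OF assms(2) spd_dyn[OF assms(1)]]
  by (simp add: kf_predict_def case_prod_unfold)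

lemma spd_kf_pred: "k < K \<Longrightarrow> spd (snd (kf_pred A y k))"
proof (induction k)
  case 0
  then show ?case by (simp add: spd_prior)
next
  case (Suc k)
  then show ?case using spd_predict spd_update by simp
qed

lemma spd_kf_filt: "k \<in> {1..K} \<Longrightarrow> spd (snd (kf_filt A y k))"
  unfolding kf_filt_def by (intro spd_update spd_kf_pred) auto

lemma kf_pred_filt:
  "1 \<le> k \<Longrightarrow> kf_pred A y k = kf_predict A k (kf_filt A y k)"
  by (cases k) (simp_all add: kf_pred_Suc del: kf_pred.simps)

text \<open>\<open>conditioning\<close> with the transition matrix in the role of \<open>H\<close>
  and the next state in the role of the measurement. The innovation term still contains
  \<open>x (Suc k)\<close> and serves as the prior cost of the next update, so no constant splits
  off here.\<close>

lemma
  assumes k: "k \<in> {1..<K}"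
  shows spd_backward_cov: "spd (backward_cov A y k)"
    and mahal_predict: "mahal (snd (kf_filt A y k)) (x k - fst (kf_filt A y k))
        + mahal (aQ A k + aOmega A k) (x (Suc k) - (aF A k *v x k + ab A k))
      = mahal (snd (kf_pred A y k)) (x (Suc k) - fst (kf_pred A y k))
        + mahal (backward_cov A y k) (rts_defect A y x k)"
proof -
  have f: "spd (snd (kf_filt A y k))" using k by (intro spd_kf_filt) auto
  have p: "snd (kf_pred A y k) =
      aF A k ** snd (kf_filt A y k) ** transpose (aF A k) + (aQ A k + aOmega A k)"
    "fst (kf_pred A y k) = aF A k *v fst (kf_filt A y k) + ab A k"
    using k by (simp_all add: kf_pred_filt kf_predict_def case_prod_unfold)
  note c = conditioning[OF f spd_dyn[OF k], where H = "aF A k", folded p(1), folded rts_gain_def,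
      folded backward_cov_def]
  show "spd (backward_cov A y k)" by (rule c)
  let ?v = "x (Suc k) - fst (kf_pred A y k)"
  have v: "?v - aF A k *v (x k - fst (kf_filt A y k)) = x (Suc k) - (aF A k *v x k + ab A k)"
    by (simp add: p(2) vec.diff)
  show "mahal (snd (kf_filt A y k)) (x k - fst (kf_filt A y k))
        + mahal (aQ A k + aOmega A k) (x (Suc k) - (aF A k *v x k + ab A k))
      = mahal (snd (kf_pred A y k)) (x (Suc k) - fst (kf_pred A y k))
        + mahal (backward_cov A y k) (rts_defect A y x k)"
    using c(2)[of "x k - fst (kf_filt A y k)" ?v] unfolding v rts_defect_def .
qed

text \<open>The invariant of the forward pass: after \<open>n\<close> updates and predictions, the
  past enters only through the predicted square of \<open>x (Suc n)\<close>, apart from squares of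
  defects. Measurement \<open>Suc n\<close> has not been used yet.\<close>

lemma forward_cost:
  assumes "n < K"
  shows "\<exists>c. \<forall>x. mahal (aP A) (x 1 - am A)
      + (\<Sum>k\<in>{1..n}. mahal (aQ A k + aOmega A k) (x (Suc k) - (aF A k *v x k + ab A k)))
      + (\<Sum>k\<in>{1..n}. mahal (aR A k + aGamma A k) (y k - (aH A k *v x k + ac A k)))
    = c + mahal (snd (kf_pred A y n)) (x (Suc n) - fst (kf_pred A y n))
      + (\<Sum>k\<in>{1..n}. mahal (backward_cov A y k) (rts_defect A y x k))"
  using assms
proof (induction n)
  case 0
  show ?case by (intro exI[of _ 0]) simp
next
  case (Suc n)
  then obtain c where c: "\<And>x. mahal (aP A) (x 1 - am A)
      + (\<Sum>k\<in>{1..n}. mahal (aQ A k + aOmega A k) (x (Suc k) - (aF A k *v x k + ab A k)))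
      + (\<Sum>k\<in>{1..n}. mahal (aR A k + aGamma A k) (y k - (aH A k *v x k + ac A k)))
    = c + mahal (snd (kf_pred A y n)) (x (Suc n) - fst (kf_pred A y n))
      + (\<Sum>k\<in>{1..n}. mahal (backward_cov A y k) (rts_defect A y x k))"
    by auto
  obtain d where d: "\<And>x. mahal (snd (kf_pred A y n)) (x - fst (kf_pred A y n))
      + mahal (aR A (Suc n) + aGamma A (Suc n)) (y (Suc n) - (aH A (Suc n) *v x + ac A (Suc n)))
    = d + mahal (snd (kf_filt A y (Suc n))) (x - fst (kf_filt A y (Suc n)))"
    using mahal_update[of "Suc n" "kf_pred A y n" y] spd_kf_pred[of n y] Suc.prems
    unfolding kf_filt_Suc by (metis Suc_leI Suc_lessD atLeastAtMost_iff le_add1 plus_1_eq_Suc)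
  have n: "Suc n \<in> {1..<K}" using Suc.prems by simp
  have s: "sum f {1..Suc n} = sum f {1..n} + f (Suc n)" for f :: "nat \<Rightarrow> real" by simp
  show ?case
  proof (intro exI[of _ "c + d"] allI)
    fix x
    show "mahal (aP A) (x 1 - am A)
      + (\<Sum>k\<in>{1..Suc n}. mahal (aQ A k + aOmega A k) (x (Suc k) - (aF A k *v x k + ab A k)))
      + (\<Sum>k\<in>{1..Suc n}. mahal (aR A k + aGamma A k) (y k - (aH A k *v x k + ac A k)))
    = c + d + mahal (snd (kf_pred A y (Suc n))) (x (Suc (Suc n)) - fst (kf_pred A y (Suc n)))
      + (\<Sum>k\<in>{1..Suc n}. mahal (backward_cov A y k) (rts_defect A y x k))"
      unfolding s using c[of x] d[of "x (Suc n)"] mahal_predict[OF n, of y x] by linarith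
  qed
qed

lemma affine_cost_decomposition:
  obtains c where "\<And>x. affine_cost A K y x
    = c + mahal (snd (kf_filt A y K)) (x K - fst (kf_filt A y K))
      + (\<Sum>k\<in>{1..<K}. mahal (backward_cov A y k) (rts_defect A y x k))"
proof -
  obtain n where n: "K = Suc n" using K by (cases K) auto
  have i: "{1..<K} = {1..n}" "{1..K} = insert (Suc n) {1..n}" by (auto simp: n)
  obtain c where c: "\<And>x. mahal (aP A) (x 1 - am A)
      + (\<Sum>k\<in>{1..n}. mahal (aQ A k + aOmega A k) (x (Suc k) - (aF A k *v x k + ab A k)))
      + (\<Sum>k\<in>{1..n}. mahal (aR A k + aGamma A k) (y k - (aH A k *v x k + ac A k)))
    = c + mahal (snd (kf_pred A y n)) (x (Suc n) - fst (kf_pred A y n))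
      + (\<Sum>k\<in>{1..n}. mahal (backward_cov A y k) (rts_defect A y x k))"
    using forward_cost[of n y] n by auto
  \<comment> \<open>The last measurement is absorbed without a subsequent prediction, which leaves
    the filter square at \<open>K\<close>.\<close>
  obtain d where d: "\<And>x. mahal (snd (kf_pred A y n)) (x - fst (kf_pred A y n))
      + mahal (aR A K + aGamma A K) (y K - (aH A K *v x + ac A K))
    = d + mahal (snd (kf_filt A y K)) (x - fst (kf_filt A y K))"
    using mahal_update[of K "kf_pred A y n" y] spd_kf_pred[of n y] K n
    unfolding n kf_filt_Suc by (metis atLeastAtMost_iff lessI order_refl)
  have "affine_cost A K y x
    = (c + d) + mahal (snd (kf_filt A y K)) (x K - fst (kf_filt A y K))
      + (\<Sum>k\<in>{1..<K}. mahal (backward_cov A y k) (rts_defect A y x k))" for x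
    unfolding affine_cost_def i
    using c[of x] d[of "x K"] by (simp add: n)
  then show thesis by (rule that)
qed

text \<open>The constant \<open>c\<close> is a lower bound and is attained at
  \<open>rts_mean A K y\<close>, where all squares vanish. Minimisers are thus the points of cost
  \<open>c\<close>, and definiteness forces every square to be zero there.\<close>

lemma affine_cost_minimiser_iff:
  "(\<forall>x'. affine_cost A K y x \<le> affine_cost A K y x') \<longleftrightarrow>
    (\<forall>k\<in>{1..K}. x k = rts_mean A K y k)"
proof -
  obtain c where c: "\<And>x. affine_cost A K y x
    = c + mahal (snd (kf_filt A y K)) (x K - fst (kf_filt A y K))
      + (\<Sum>k\<in>{1..<K}. mahal (backward_cov A y k) (rts_defect A y x k))"
    using affine_cost_decomposition by blast
  have f: "spd (snd (kf_filt A y K))" using K by (intro spd_kf_filt) simp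
  have pos: "0 \<le> mahal (snd (kf_filt A y K)) v"
    "0 \<le> (\<Sum>k\<in>{1..<K}. mahal (backward_cov A y k) (rts_defect A y z k))" for v z
    by (auto intro!: sum_nonneg mahal_nonneg spd_backward_cov f)
  have c_iff: "affine_cost A K y z = c \<longleftrightarrow> (\<forall>k\<in>{1..K}. z k = rts_mean A K y k)" for z
  proof -
    have "affine_cost A K y z = c \<longleftrightarrow> mahal (snd (kf_filt A y K)) (z K - fst (kf_filt A y K)) = 0
      \<and> (\<Sum>k\<in>{1..<K}. mahal (backward_cov A y k) (rts_defect A y z k)) = 0"
      unfolding c using pos(1)[of "z K - fst (kf_filt A y K)"] pos(2)[of z] by linarith
    also have "\<dots> \<longleftrightarrow> (\<forall>k\<in>{1..K}. z k = rts_mean A K y k)"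
      unfolding rts_mean_unique[OF K] mahal_eq_0_iff[OF f]
      by (subst sum_nonneg_eq_0_iff) (auto simp: mahal_eq_0_iff spd_backward_cov mahal_nonneg)
    finally show ?thesis .
  qed
  have ge: "c \<le> affine_cost A K y z" for z
    unfolding c using pos(1)[of "z K - fst (kf_filt A y K)"] pos(2)[of z] by linarith
  show ?thesis
    using c_iff[of x] c_iff[of "rts_mean A K y"] ge by (metis order_antisym)
qed

text \<open>Each square is an even function of a vector that is affine in \<open>x\<close> and
  vanishes at the smoothed means, so reflection only flips the sign of that vector.\<close>

lemma affine_cost_reflect:
  "affine_cost A K y (\<lambda>k. 2 *\<^sub>R rts_mean A K y k - x k) = affine_cost A K y x"
proof -
  obtain c where c: "\<And>x. affine_cost A K y x
    = c + mahal (snd (kf_filt A y K)) (x K - fst (kf_filt A y K))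
      + (\<Sum>k\<in>{1..<K}. mahal (backward_cov A y k) (rts_defect A y x k))"
    using affine_cost_decomposition by blast
  have r: "rts_defect A y (\<lambda>k. 2 *\<^sub>R rts_mean A K y k - x k) k = - rts_defect A y x k"
    if "k \<in> {1..<K}" for k
  proof -
    have "rts_defect A y (\<lambda>k. 2 *\<^sub>R rts_mean A K y k - x k) k =
      2 *\<^sub>R rts_defect A y (rts_mean A K y) k - rts_defect A y x k"
      by (simp add: rts_defect_def vec.diff matrix_vector_mult_scaleR scaleR_diff_right algebra_simps)
        (simp add: scaleR_2)
    moreover have "rts_defect A y (rts_mean A K y) k = 0"
      using rts_mean_unique[OF K, of "rts_mean A K y" A y] that by simp
    ultimately show ?thesis by simp
  qed
  have l: "2 *\<^sub>R rts_mean A K y K - x K - fst (kf_filt A y K) = - (x K - fst (kf_filt A y K))"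
    by (simp add: rts_mean_last scaleR_2)
  show ?thesis unfolding c l mahal_minus by (simp add: r del: minus_diff_eq)
qed

end

section \<open>Stein's identity for the SLR expectation\<close>

lemma borel_measurable_matrix_vector [measurable]:
  fixes A :: "real^'n^'m"
  assumes "f \<in> borel_measurable M"
  shows "(\<lambda>w. A *v f w) \<in> borel_measurable M"
proof -
  have "(\<lambda>v. A *v v) \<in> borel_measurable borel"
    by (intro borel_measurable_continuous_onI linear_continuous_on) simp
  then show ?thesis using assms by (rule measurable_compose_rev)
qed

lemma borel_measurable_gauss_density [measurable]:
  "gauss_density m P \<in> borel_measurable borel"
  unfolding gauss_density_def[abs_def] by measurable

text \<open>Exponential tilting: moving the mean multiplies the density by an explicit factor.
  Derivatives in \<open>t\<close> then fall on this factor and never on the function that is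
  averaged.\<close>

lemma gauss_density_shift:
  fixes P :: "real^'n^'n"
  assumes "spd P"
  shows "gauss_density (x + t *\<^sub>R e) P \<xi> = exp (- (t\<^sup>2 / 2) * mahal P e) *
    (gauss_density x P \<xi> * exp (t * (e \<bullet> (matrix_inv P *v (\<xi> - x)))))"
proof -
  define u where "u = \<xi> - x"
  have "u \<bullet> (matrix_inv P *v e) = e \<bullet> (matrix_inv P *v u)"
    using spd_inv_inner_commute[OF assms, of u e] by (simp add: inner_commute)
  then have "(u - t *\<^sub>R e) \<bullet> (matrix_inv P *v (u - t *\<^sub>R e))
      = u \<bullet> (matrix_inv P *v u) - 2 * t * (e \<bullet> (matrix_inv P *v u)) + t\<^sup>2 * mahal P e"
    by (simp add: vec.diff matrix_vector_mult_scaleR inner_diff_left inner_diff_right mahal_def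
        power2_eq_square right_diff_distrib)
  then have q: "(\<xi> - (x + t *\<^sub>R e)) \<bullet> (matrix_inv P *v (\<xi> - (x + t *\<^sub>R e)))
      = u \<bullet> (matrix_inv P *v u) - 2 * t * (e \<bullet> (matrix_inv P *v u)) + t\<^sup>2 * mahal P e"
    unfolding u_def diff_diff_eq .
  show ?thesis
    unfolding gauss_density_def q u_def
    by (simp add: mult_exp_exp field_simps)
qed

text \<open>
  Multiplied by the density, the right-hand side is a combination of the densities shifted by twice the
  direction, so the moment assumption at all points supplies the dominating function.
\<close>

lemma exp_quotient_bound:
  fixes a t :: real
  assumes "\<bar>t\<bar> \<le> 1" "t \<noteq> 0"
  shows "\<bar>(exp (t * a) - 1) / t\<bar> \<le> exp (2 * a) + exp (- (2 * a))"
proof -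
  have "\<bar>exp u - 1\<bar> \<le> \<bar>u\<bar> * exp \<bar>u\<bar>" for u :: real
  proof (cases "0 \<le> u")
    case True
    have "(1 - u) * exp u \<le> exp (- u) * exp u"
      using exp_ge_add_one_self[of "- u"] by (intro mult_right_mono) auto
    then have "exp u - 1 \<le> u * exp u" by (simp add: mult_exp_exp algebra_simps)
    then show ?thesis using True by simp
  next
    case False
    have "1 - exp u \<le> - u" using exp_ge_add_one_self[of u] by linarith
    also have "\<dots> \<le> - u * exp (- u)" using False by (simp add: mult_le_cancel_left1)
    finally show ?thesis using False by simp
  qed
  from this[of "t * a"] have "\<bar>(exp (t * a) - 1) / t\<bar> \<le> \<bar>a\<bar> * exp \<bar>t * a\<bar>"
    using assms by (simp add: abs_mult field_simps)
  also have "\<dots> \<le> exp \<bar>a\<bar> * exp \<bar>a\<bar>"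
  proof (intro mult_mono)
    show "\<bar>a\<bar> \<le> exp \<bar>a\<bar>" using exp_ge_add_one_self[of "\<bar>a\<bar>"] by linarith
    show "exp \<bar>t * a\<bar> \<le> exp \<bar>a\<bar>" using assms by (simp add: abs_mult mult_left_le_one_le)
  qed auto
  also have "\<dots> = exp (2 * \<bar>a\<bar>)" by (simp add: mult_exp_exp)
  also have "\<dots> \<le> exp (2 * a) + exp (- (2 * a))" by (cases "0 \<le> a") auto
  finally show ?thesis .
qed

text \<open>Differentiation under the integral sign after tilting. The function \<open>f\<close> is
  merely integrable against every shifted density, so all smoothness comes from the Gaussian. The
  same dominated convergence yields integrability of the limit.\<close>

lemma
  fixes f :: "real^'n \<Rightarrow> real"
  assumes P: "spd P" and int: "\<And>x. integrable lborel (\<lambda>\<xi>. gauss_density x P \<xi> * f \<xi>)"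
  defines "a \<equiv> \<lambda>x e \<xi>. e \<bullet> (matrix_inv P *v (\<xi> - x))"
  shows integrable_gauss_score: "integrable lborel (\<lambda>\<xi>. gauss_density x P \<xi> * f \<xi> * a x e \<xi>)"
    and gauss_expectation_derivative:
      "((\<lambda>t. \<integral>\<xi>. gauss_density (x + t *\<^sub>R e) P \<xi> * f \<xi> \<partial>lborel) has_real_derivative
        (\<integral>\<xi>. gauss_density x P \<xi> * f \<xi> * a x e \<xi> \<partial>lborel)) (at 0)"
proof -
  define c where "c = mahal P e"
  define b where "b = a x e"
  define p where "p = (\<lambda>\<xi>. gauss_density x P \<xi> * f \<xi>)"
  have [measurable]: "b \<in> borel_measurable borel" unfolding b_def a_def by measurable
  have p_int: "integrable lborel p" unfolding p_def by (rule int)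
  then have [measurable]: "p \<in> borel_measurable borel" by auto
  have shift: "gauss_density (x + t *\<^sub>R e) P \<xi> * f \<xi> = exp (- (t\<^sup>2 / 2) * c) * (p \<xi> * exp (t * b \<xi>))" for t \<xi>
    unfolding gauss_density_shift[OF P] p_def b_def a_def c_def by simp
  \<comment> \<open>The hypothesis at the shifted mean \<open>x + t *\<^sub>R e\<close>, with the
    tilting constant undone.\<close>
  have int_exp: "integrable lborel (\<lambda>\<xi>. p \<xi> * exp (t * b \<xi>))" for t
  proof -
    have "integrable lborel (\<lambda>\<xi>. exp (t\<^sup>2 / 2 * c) * (gauss_density (x + t *\<^sub>R e) P \<xi> * f \<xi>))"
      by (intro integrable_mult_right int)
    then show ?thesis unfolding shift by (simp add: mult.assoc[symmetric] mult_exp_exp)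
  qed
  define h where "h t = (\<integral>\<xi>. p \<xi> * exp (t * b \<xi>) \<partial>lborel)" for t
  \<comment> \<open>The tilts at \<open>t = 2\<close> and \<open>t = -2\<close>, matching
    \<open>exp_quotient_bound\<close>.\<close>
  define w where "w \<xi> = \<bar>p \<xi> * exp (2 * b \<xi>)\<bar> + \<bar>p \<xi> * exp (- 2 * b \<xi>)\<bar>" for \<xi>
  have w: "integrable lborel w"
    unfolding w_def by (intro Bochner_Integration.integrable_add integrable_abs int_exp)
  have lim: "((\<lambda>t. (exp (t * b \<xi>) - 1) / t) \<longlongrightarrow> b \<xi>) (at 0)" for \<xi>
  proof -
    have "((\<lambda>t. exp (t * b \<xi>)) has_real_derivative b \<xi>) (at 0)"
      by (auto intro!: derivative_eq_intros)
    then show ?thesis by (simp add: has_field_derivative_iff)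
  qed
  have bound: "\<bar>p \<xi> * ((exp (t * b \<xi>) - 1) / t)\<bar> \<le> w \<xi>" if "\<bar>t\<bar> \<le> 1" "t \<noteq> 0" for t \<xi>
  proof -
    have "\<bar>p \<xi> * ((exp (t * b \<xi>) - 1) / t)\<bar> \<le> \<bar>p \<xi>\<bar> * (exp (2 * b \<xi>) + exp (- (2 * b \<xi>)))"
      unfolding abs_mult[of "p \<xi>"] by (intro mult_left_mono exp_quotient_bound that) auto
    then show ?thesis by (simp add: w_def abs_mult distrib_left)
  qed
  have seq: "(\<lambda>n. (h (X n) - h 0) / X n) \<longlonglongrightarrow> (\<integral>\<xi>. p \<xi> * b \<xi> \<partial>lborel)
      \<and> integrable lborel (\<lambda>\<xi>. p \<xi> * b \<xi>)"
    if X: "X \<longlonglongrightarrow> 0" "\<And>n. X n \<noteq> 0" "\<And>n. \<bar>X n\<bar> \<le> 1" for X :: "nat \<Rightarrow> real"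
  proof -
    have m: "(\<lambda>\<xi>. p \<xi> * b \<xi>) \<in> borel_measurable lborel" by measurable
    have l: "AE \<xi> in lborel. (\<lambda>n. p \<xi> * ((exp (X n * b \<xi>) - 1) / X n)) \<longlonglongrightarrow> p \<xi> * b \<xi>"
    proof (intro AE_I2 tendsto_mult tendsto_const)
      fix \<xi>
      have "filterlim X (at 0) sequentially" using X by (auto simp: filterlim_at)
      then show "(\<lambda>n. (exp (X n * b \<xi>) - 1) / X n) \<longlonglongrightarrow> b \<xi>"
        by (rule filterlim_compose[OF lim])
    qed
    have bd: "\<And>n. AE \<xi> in lborel. norm (p \<xi> * ((exp (X n * b \<xi>) - 1) / X n)) \<le> w \<xi>"
      using bound X by auto
    have ms: "\<And>n. (\<lambda>\<xi>. p \<xi> * ((exp (X n * b \<xi>) - 1) / X n)) \<in> borel_measurable lborel" by measurable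
    have quot: "(h (X n) - h 0) / X n = (\<integral>\<xi>. p \<xi> * ((exp (X n * b \<xi>) - 1) / X n) \<partial>lborel)" for n
    proof -
      have "h (X n) - h 0 = (\<integral>\<xi>. p \<xi> * exp (X n * b \<xi>) - p \<xi> * exp (0 * b \<xi>) \<partial>lborel)"
        unfolding h_def by (rule Bochner_Integration.integral_diff[symmetric]) (rule int_exp)+
      also have "\<dots> / X n = (\<integral>\<xi>. (p \<xi> * exp (X n * b \<xi>) - p \<xi> * exp (0 * b \<xi>)) / X n \<partial>lborel)"
        by simp
      finally show ?thesis by (simp add: algebra_simps)
    qed
    show ?thesis
      unfolding quot
      using integral_dominated_convergence[OF m ms w l bd] integrable_dominated_convergence[OF m ms w l bd]
      by blast
  qed
  \<comment> \<open>Any admissible null sequence gives integrability; \<open>1 / (n + 1)\<close> is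
    a concrete one.\<close>
  have "integrable lborel (\<lambda>\<xi>. p \<xi> * b \<xi>)"
    using seq[of "\<lambda>n. inverse (real (Suc n))"] LIMSEQ_inverse_real_of_nat by (auto simp: field_simps)
  then show "integrable lborel (\<lambda>\<xi>. gauss_density x P \<xi> * f \<xi> * a x e \<xi>)"
    by (simp add: p_def b_def)
  have "((\<lambda>t. (h t - h 0) / (t - 0)) \<longlongrightarrow> (\<integral>\<xi>. p \<xi> * b \<xi> \<partial>lborel)) (at 0)"
    unfolding tendsto_at_iff_sequentially
  proof (intro allI impI)
    fix X :: "nat \<Rightarrow> real" assume X: "\<forall>i. X i \<in> UNIV - {0}" "X \<longlonglongrightarrow> 0"
    then obtain N where N: "\<And>n. n \<ge> N \<Longrightarrow> \<bar>X n\<bar> < 1"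
      using LIMSEQ_D[OF X(2), of 1] by auto
    have "(\<lambda>n. (h (X (n + N)) - h 0) / X (n + N)) \<longlonglongrightarrow> (\<integral>\<xi>. p \<xi> * b \<xi> \<partial>lborel)"
      using seq[of "\<lambda>n. X (n + N)"] X LIMSEQ_ignore_initial_segment[OF X(2), of N] N
      by (simp add: less_imp_le)
    then have "(\<lambda>n. (h (X n) - h 0) / X n) \<longlonglongrightarrow> (\<integral>\<xi>. p \<xi> * b \<xi> \<partial>lborel)"
      by (rule LIMSEQ_offset)
    then show "((\<lambda>t. (h t - h 0) / (t - 0)) \<circ> X) \<longlonglongrightarrow> (\<integral>\<xi>. p \<xi> * b \<xi> \<partial>lborel)"
      by (simp add: o_def)
  qed
  then have h: "(h has_real_derivative (\<integral>\<xi>. p \<xi> * b \<xi> \<partial>lborel)) (at 0)"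
    by (simp add: has_field_derivative_iff)
  \<comment> \<open>The prefactor has value 1 and derivative 0 at 0, so only the derivative of
    \<open>h\<close> survives.\<close>
  have "((\<lambda>t. exp (- (t\<^sup>2 / 2) * c) * h t) has_real_derivative (\<integral>\<xi>. p \<xi> * b \<xi> \<partial>lborel)) (at 0)"
    by (auto intro!: derivative_eq_intros h)
  moreover have "(\<integral>\<xi>. gauss_density (x + t *\<^sub>R e) P \<xi> * f \<xi> \<partial>lborel) = exp (- (t\<^sup>2 / 2) * c) * h t" for t
    unfolding shift h_def by simp
  ultimately show "((\<lambda>t. \<integral>\<xi>. gauss_density (x + t *\<^sub>R e) P \<xi> * f \<xi> \<partial>lborel) has_real_derivative
        (\<integral>\<xi>. gauss_density x P \<xi> * f \<xi> * a x e \<xi> \<partial>lborel)) (at 0)"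
    by (simp add: p_def b_def)
qed

text \<open>The integrand is odd about \<open>x\<close>, and the point reflection at
  \<open>x\<close> preserves Lebesgue measure, hence \<open>?I = - ?I\<close>. This says that the
  Gaussian score has mean zero.\<close>

lemma gauss_odd_integral:
  fixes x :: "real^'n"
  shows "(\<integral>\<xi>. gauss_density x P \<xi> * (e \<bullet> (matrix_inv P *v (\<xi> - x))) \<partial>lborel) = 0" (is "?I = 0")
proof -
  let ?f = "\<lambda>\<xi>. gauss_density x P \<xi> * (e \<bullet> (matrix_inv P *v (\<xi> - x)))"
  have refl: "?f (2 *\<^sub>R x + (-1) *\<^sub>R \<xi>) = - ?f \<xi>" for \<xi>
  proof -
    define u where "u = \<xi> - x"
    have "2 *\<^sub>R x + (-1) *\<^sub>R \<xi> - x = - u" by (simp add: u_def scaleR_2)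
    then show ?thesis unfolding gauss_density_def u_def[symmetric] by (simp add: vec.neg)
  qed
  have "?I = integral\<^sup>L (distr lborel borel (\<lambda>\<xi>. 2 *\<^sub>R x + (-1) *\<^sub>R \<xi>)) ?f"
    using lborel_affine[of "-1" "2 *\<^sub>R x"] by (simp add: density_1)
  also have "\<dots> = (\<integral>\<xi>. ?f (2 *\<^sub>R x + (-1) *\<^sub>R \<xi>) \<partial>lborel)"
    by (rule integral_distr) measurable
  also have "\<dots> = - ?I" unfolding refl by simp
  finally show ?thesis by simp
qed

lemma integrable_vec_nth:
  fixes f :: "'a \<Rightarrow> 'b::euclidean_space^'n"
  shows "integrable M f \<Longrightarrow> integrable M (\<lambda>w. f w $ i)"
  by (rule integrable_bounded_linear[OF bounded_linear_vec_nth])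

lemma integral_vec_nth:
  fixes f :: "'a \<Rightarrow> 'b::euclidean_space^'n"
  shows "integrable M f \<Longrightarrow> (\<integral>w. f w $ i \<partial>M) = (\<integral>w. f w \<partial>M) $ i"
  by (rule integral_bounded_linear[OF bounded_linear_vec_nth])

text \<open>Stein's identity by coordinates: differentiating the mean inserts the score
  \<open>matrix_inv P *v (\<xi> - x)\<close> into the integral, and the slope is the covariance of
  \<open>g\<close> with that same vector.\<close>

lemma slr_mean_partial_derivative:
  fixes g :: "real^'n \<Rightarrow> real^'b"
  assumes P: "spd P" and fin: "slr_moments_finite g P"
  shows "((\<lambda>t. slr_mean g P (x + t *\<^sub>R axis l 1) $ i) has_real_derivative slr_slope g P x $ i $ l) (at 0)"
proof -
  let ?p = "gauss_density x P" and ?m = "slr_mean g P x"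
  define b where "b \<xi> = axis l 1 \<bullet> (matrix_inv P *v (\<xi> - x))" for \<xi> :: "real^'n"
  have int: "integrable lborel (\<lambda>\<xi>. gauss_density x P \<xi> *\<^sub>R g \<xi>)" for x
    using fin by (simp add: slr_moments_finite_def)
  have int_i: "integrable lborel (\<lambda>\<xi>. gauss_density x P \<xi> * g \<xi> $ i)" for x
    using integrable_vec_nth[OF int, of x i] by simp
  have mean_i: "slr_mean g P x $ i = (\<integral>\<xi>. gauss_density x P \<xi> * g \<xi> $ i \<partial>lborel)" for x
    unfolding slr_mean_def using integral_vec_nth[OF int, of x i] by simp
  have int_Psi: "integrable lborel (\<lambda>\<xi>. ?p \<xi> *\<^sub>R outer (\<xi> - x) (g \<xi> - ?m))"
    using fin by (simp add: slr_moments_finite_def)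
  have int_Psi_k: "integrable lborel (\<lambda>\<xi>. ?p \<xi> * ((\<xi> - x) $ k * (g \<xi> - ?m) $ i))" for k
    using integrable_vec_nth[OF integrable_vec_nth[OF int_Psi, of k], of i] by (simp add: outer_def)
  have Psi_k: "slr_Psi g P x $ k $ i = (\<integral>\<xi>. ?p \<xi> * ((\<xi> - x) $ k * (g \<xi> - ?m) $ i) \<partial>lborel)" for k
    unfolding slr_Psi_def integral_vec_nth[OF int_Psi, symmetric]
      integral_vec_nth[OF integrable_vec_nth[OF int_Psi], symmetric]
    by (simp add: outer_def)
  \<comment> \<open>The slope multiplies by the inverse covariance from the right, the score from
    the left; symmetry reconciles the two.\<close>
  have "transpose (matrix_inv P) $ l $ k = matrix_inv P $ l $ k" for k
    using spd_matrix_inv[OF P] by (simp add: spd_def)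
  then have sym: "matrix_inv P $ k $ l = matrix_inv P $ l $ k" for k
    by (simp add: transpose_def)
  have b_sum: "(\<Sum>k\<in>UNIV. (\<xi> - x) $ k * matrix_inv P $ k $ l) = b \<xi>" for \<xi>
    by (simp add: b_def inner_axis' matrix_vector_mult_def sym mult.commute)
  have expand: "(\<Sum>k\<in>UNIV. (?p \<xi> * ((\<xi> - x) $ k * (g \<xi> - ?m) $ i)) * matrix_inv P $ k $ l)
      = ?p \<xi> * (g \<xi> - ?m) $ i * b \<xi>" for \<xi>
    unfolding b_sum[symmetric] sum_distrib_left by (intro sum.cong) auto
  have int_c: "integrable lborel (\<lambda>\<xi>. ?p \<xi> * (g \<xi> - ?m) $ i * b \<xi>)"
    unfolding expand[symmetric] by (intro Bochner_Integration.integrable_sum integrable_mult_left int_Psi_k)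
  have "slr_slope g P x $ i $ l
      = (\<Sum>k\<in>UNIV. (\<integral>\<xi>. ?p \<xi> * ((\<xi> - x) $ k * (g \<xi> - ?m) $ i) \<partial>lborel) * matrix_inv P $ k $ l)"
    by (simp add: slr_slope_def matrix_matrix_mult_def transpose_def Psi_k)
  also have "\<dots> = (\<integral>\<xi>. (\<Sum>k\<in>UNIV. (?p \<xi> * ((\<xi> - x) $ k * (g \<xi> - ?m) $ i)) * matrix_inv P $ k $ l) \<partial>lborel)"
    by (subst Bochner_Integration.integral_sum) (rule integrable_mult_left int_Psi_k | simp)+
  also have "\<dots> = (\<integral>\<xi>. ?p \<xi> * (g \<xi> - ?m) $ i * b \<xi> \<partial>lborel)" unfolding expand ..
  \<comment> \<open>Centring \<open>g\<close> at its mean changes nothing, because the score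
    integrates to zero.\<close>
  also have "\<dots> = (\<integral>\<xi>. ?p \<xi> * g \<xi> $ i * b \<xi> \<partial>lborel)"
  proof -
    have score: "integrable lborel (\<lambda>\<xi>. ?p \<xi> * g \<xi> $ i * b \<xi>)"
      unfolding b_def by (rule integrable_gauss_score[OF P int_i])
    have "(\<integral>\<xi>. ?p \<xi> * g \<xi> $ i * b \<xi> \<partial>lborel) - (\<integral>\<xi>. ?p \<xi> * (g \<xi> - ?m) $ i * b \<xi> \<partial>lborel)
        = (\<integral>\<xi>. ?p \<xi> * g \<xi> $ i * b \<xi> - ?p \<xi> * (g \<xi> - ?m) $ i * b \<xi> \<partial>lborel)"
      by (rule Bochner_Integration.integral_diff[symmetric]) (fact score int_c)+
    also have "\<dots> = (\<integral>\<xi>. ?m $ i * (?p \<xi> * b \<xi>) \<partial>lborel)"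
      by (intro Bochner_Integration.integral_cong) (auto simp: algebra_simps)
    also have "\<dots> = 0" using gauss_odd_integral[of x P "axis l 1"] by (simp add: b_def)
    finally show ?thesis by simp
  qed
  finally have slope: "slr_slope g P x $ i $ l = (\<integral>\<xi>. ?p \<xi> * g \<xi> $ i * b \<xi> \<partial>lborel)" .
  show ?thesis
    unfolding mean_i slope b_def by (rule gauss_expectation_derivative[OF P int_i])
qed

section \<open>The Gauss--Newton objective\<close>

lemma sum_res_index:
  fixes f :: "('n::finite, 'm::finite) ridx \<Rightarrow> real"
  shows "(\<Sum>a\<in>res_index K. f a) = (\<Sum>i\<in>UNIV. f (PriorRow i))
    + (\<Sum>k\<in>{1..<K}. \<Sum>i\<in>UNIV. f (DynRow k i)) + (\<Sum>k\<in>{1..K}. \<Sum>i\<in>UNIV. f (ObsRow k i))"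
proof -
  have "(\<Sum>a\<in>res_index K. f a) = sum f (range PriorRow)
    + sum f ((\<lambda>(k, i). DynRow k i) ` ({1..<K} \<times> UNIV))
    + sum f ((\<lambda>(k, i). ObsRow k i) ` ({1..K} \<times> UNIV))"
    unfolding res_index_def by (subst sum.union_disjoint, force, force, force)+ simp
  also have "sum f (range PriorRow) = (\<Sum>i\<in>UNIV. f (PriorRow i))"
    by (subst sum.reindex) (auto simp: inj_on_def)
  also have "sum f ((\<lambda>(k, i). DynRow k i) ` ({1..<K} \<times> UNIV)) = (\<Sum>k\<in>{1..<K}. \<Sum>i\<in>UNIV. f (DynRow k i))"
    by (subst sum.reindex) (auto simp: inj_on_def sum.cartesian_product case_prod_unfold)
  also have "sum f ((\<lambda>(k, i). ObsRow k i) ` ({1..K} \<times> UNIV)) = (\<Sum>k\<in>{1..K}. \<Sum>i\<in>UNIV. f (ObsRow k i))"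
    by (subst sum.reindex) (auto simp: inj_on_def sum.cartesian_product case_prod_unfold)
  finally show ?thesis .
qed

lemma mahal_sum: "mahal P v = (\<Sum>i\<in>UNIV. v $ i * (\<Sum>j\<in>UNIV. matrix_inv P $ i $ j * v $ j))"
  by (simp add: mahal_def inner_vec_def matrix_vector_mult_def)

text \<open>Arbitrary blocks in the residual layout, so that one whitening lemma serves both the
  nonlinear residual and its linearisation.\<close>

fun stack :: "real^'n \<Rightarrow> (nat \<Rightarrow> real^'n) \<Rightarrow> (nat \<Rightarrow> real^'m) \<Rightarrow> ('n, 'm) ridx \<Rightarrow> real" where
  "stack p u v (PriorRow i) = p $ i"
| "stack p u v (DynRow k i) = u k $ i"
| "stack p u v (ObsRow k i) = v k $ i"

text \<open>Only the product of \<open>S\<close> with its transpose enters the squared norm, so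
  every choice of square root gives the same cost; the block structure of \<open>Sigma_inv\<close>
  then separates the times.\<close>

lemma sq_norm_whitened:
  fixes md :: "('n::finite, 'm::finite) ssm"
  assumes S: "is_Sigma_inv_sqrt md K xh P S"
  shows "sq_norm_on (res_index K) (\<lambda>a. \<Sum>b\<in>res_index K. S b a * stack p u v b) =
    mahal (prior_cov md) p
    + (\<Sum>k\<in>{1..<K}. mahal (Qcov md k + Omega_at md xh P k) (u k))
    + (\<Sum>k\<in>{1..K}. mahal (Rcov md k + Gamma_at md xh P k) (v k))"
proof -
  let ?I = "res_index K :: ('n, 'm) ridx set" and ?z = "stack p u v"
  have "sq_norm_on ?I (\<lambda>a. \<Sum>b\<in>?I. S b a * ?z b)
    = (\<Sum>a\<in>?I. \<Sum>b\<in>?I. \<Sum>c\<in>?I. ?z b * (S b a * S c a) * ?z c)"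
    by (simp add: sq_norm_on_def power2_eq_square sum_product algebra_simps)
  also have "\<dots> = (\<Sum>b\<in>?I. \<Sum>a\<in>?I. \<Sum>c\<in>?I. ?z b * (S b a * S c a) * ?z c)"
    by (rule sum.swap)
  also have "\<dots> = (\<Sum>b\<in>?I. \<Sum>c\<in>?I. \<Sum>a\<in>?I. ?z b * (S b a * S c a) * ?z c)"
    by (intro sum.cong refl sum.swap)
  also have "\<dots> = (\<Sum>b\<in>?I. ?z b * (\<Sum>c\<in>?I. Sigma_inv md xh P b c * ?z c))"
  proof (intro sum.cong refl)
    fix b assume b: "b \<in> ?I"
    have "(\<Sum>c\<in>?I. \<Sum>a\<in>?I. ?z b * (S b a * S c a) * ?z c)
      = ?z b * (\<Sum>c\<in>?I. (\<Sum>a\<in>?I. S b a * S c a) * ?z c)"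
      by (simp add: sum_distrib_left sum_distrib_right mult.assoc)
    also have "(\<Sum>c\<in>?I. (\<Sum>a\<in>?I. S b a * S c a) * ?z c) = (\<Sum>c\<in>?I. Sigma_inv md xh P b c * ?z c)"
      using S b by (intro sum.cong) (auto simp: is_Sigma_inv_sqrt_def)
    finally show "(\<Sum>c\<in>?I. \<Sum>a\<in>?I. ?z b * (S b a * S c a) * ?z c)
      = ?z b * (\<Sum>c\<in>?I. Sigma_inv md xh P b c * ?z c)" .
  qed
  also have "\<dots> = mahal (prior_cov md) p
    + (\<Sum>k\<in>{1..<K}. mahal (Qcov md k + Omega_at md xh P k) (u k))
    + (\<Sum>k\<in>{1..K}. mahal (Rcov md k + Gamma_at md xh P k) (v k))"
  proof -
    \<comment> \<open>Off-diagonal blocks vanish, so the inner sum collapses to the block of its own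
      time index.\<close>
    have if_sum: "(\<Sum>l\<in>L. \<Sum>j\<in>UNIV. (if k = l then f l j else 0) * g l j) = (\<Sum>j\<in>UNIV. f k j * g k j)"
      if "k \<in> L" "finite L" for k :: nat and L and f g :: "nat \<Rightarrow> 'q::finite \<Rightarrow> real"
    proof -
      have "(\<Sum>l\<in>L. \<Sum>j\<in>UNIV. (if k = l then f l j else 0) * g l j)
        = (\<Sum>l\<in>L. if k = l then \<Sum>j\<in>UNIV. f l j * g l j else 0)"
        by (intro sum.cong) auto
      then show ?thesis using that by simp
    qed
    show ?thesis
      unfolding sum_res_index by (simp add: mahal_sum if_sum)
  qed
  finally show ?thesis .
qed

lemma stacked_z_stack: "stacked_z md P y x = stack (x 1 - prior_mean md)
    (\<lambda>k. x (Suc k) - slr_mean (dyn md k) (P k) (x k)) (\<lambda>k. y k - slr_mean (obs md k) (P k) (x k))"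
proof
  fix a show "stacked_z md P y x a = stack (x 1 - prior_mean md)
    (\<lambda>k. x (Suc k) - slr_mean (dyn md k) (P k) (x k)) (\<lambda>k. y k - slr_mean (obs md k) (P k) (x k)) a"
    by (cases a) auto
qed

lemma L_IPLS_residual:
  assumes "is_Sigma_inv_sqrt md K xh P S"
  shows "L_IPLS md K xh P y x = 1/2 * sq_norm_on (res_index K) (residual md K P y S x)"
  unfolding L_IPLS_def residual_def stacked_z_stack sq_norm_whitened[OF assms] mahal_def ..

text \<open>The Jacobian of \<open>stacked_z\<close> at the current estimate, when \<open>A\<close>
  is the SLR model there. A dynamics row depends on the two states \<open>k\<close> and
  \<open>Suc k\<close>, every other row on one.\<close>

fun stacked_z_partial :: "('n::finite, 'm::finite) affine_model \<Rightarrow> ('n, 'm) ridx \<Rightarrow> nat \<Rightarrow> 'n \<Rightarrow> real" where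
  "stacked_z_partial A (PriorRow i) j l = (if j = 1 then axis l 1 $ i else 0)"
| "stacked_z_partial A (DynRow k i) j l =
     (if j = Suc k then axis l 1 $ i else 0) - (if j = k then aF A k $ i $ l else 0)"
| "stacked_z_partial A (ObsRow k i) j l = - (if j = k then aH A k $ i $ l else 0)"

context
  fixes md :: "('n::finite, 'm::finite) ssm" and K :: nat
    and xh :: "nat \<Rightarrow> real^'n" and P :: "nat \<Rightarrow> real^'n^'n"
  assumes K: "1 \<le> K"
    and P: "\<And>k. k \<in> {1..K} \<Longrightarrow> spd (P k)"
    and dyn_fin: "\<And>k. k \<in> {1..<K} \<Longrightarrow> slr_moments_finite (dyn md k) (P k)"
    and obs_fin: "\<And>k. k \<in> {1..K} \<Longrightarrow> slr_moments_finite (obs md k) (P k)"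
begin

lemma stacked_z_has_partial:
  assumes "b \<in> res_index K"
  shows "((\<lambda>t. stacked_z md P y (xh(j := xh j + t *\<^sub>R axis l 1)) b) has_real_derivative
    stacked_z_partial (slr_affine_model md xh P) b j l) (at 0)"
proof -
  have upd: "((\<lambda>t. (xh(j := xh j + t *\<^sub>R axis l 1)) k $ i) has_real_derivative
      (if j = k then axis l 1 $ i else 0)) (at 0)" for k i
    by (auto intro!: derivative_eq_intros)
  have mean: "((\<lambda>t. slr_mean g (P k) ((xh(j := xh j + t *\<^sub>R axis l 1)) k) $ i) has_real_derivative
      (if j = k then slr_slope g (P k) (xh k) $ i $ l else 0)) (at 0)"
    if "k \<in> {1..K}" "slr_moments_finite g (P k)" for k i and g :: "real^'n \<Rightarrow> real^'q"
    using slr_mean_partial_derivative[OF P[OF that(1)] that(2)] by auto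
  show ?thesis
  proof (cases b)
    case (PriorRow i)
    show ?thesis
      unfolding PriorRow stacked_z.simps stacked_z_partial.simps vector_minus_component
      by (rule DERIV_cong[OF DERIV_diff[OF upd DERIV_const]]) simp
  next
    case (DynRow k i)
    then have k: "k \<in> {1..<K}" using assms by (auto simp: res_index_def)
    then have "k \<in> {1..K}" by simp
    have aF: "aF (slr_affine_model md xh P) k = slr_slope (dyn md k) (P k) (xh k)"
      by (simp add: slr_affine_model_def)
    from DERIV_diff[OF upd[of "Suc k" i] mean[OF \<open>k \<in> {1..K}\<close> dyn_fin[OF k], of i]] show ?thesis
      unfolding DynRow stacked_z.simps stacked_z_partial.simps vector_minus_component aF .
  next
    case (ObsRow k i)
    then have k: "k \<in> {1..K}" using assms by (auto simp: res_index_def)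
    have aH: "aH (slr_affine_model md xh P) k = slr_slope (obs md k) (P k) (xh k)"
      by (simp add: slr_affine_model_def)
    from DERIV_diff[OF DERIV_const mean[OF k obs_fin[OF k], of i], of "y k $ i"] show ?thesis
      unfolding ObsRow stacked_z.simps stacked_z_partial.simps vector_minus_component aH diff_0 .
  qed
qed

lemma jacobian_residual:
  "jacobian_entry (residual md K P y S) xh a (j, l) =
    (\<Sum>b\<in>res_index K. S b a * stacked_z_partial (slr_affine_model md xh P) b j l)"
proof -
  have "((\<lambda>t. residual md K P y S (xh(j := xh j + t *\<^sub>R axis l 1)) a) has_real_derivative
    (\<Sum>b\<in>res_index K. S b a * stacked_z_partial (slr_affine_model md xh P) b j l)) (at 0)"
    unfolding residual_def by (intro DERIV_sum DERIV_cmult stacked_z_has_partial)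
  then show ?thesis by (simp add: jacobian_entry_def DERIV_imp_deriv)
qed

text \<open>The SLR offset is the mean minus the slope times the current estimate, so a first-order
  expansion with the SLR slope as derivative is exactly the residual of the affine model.\<close>

lemma stacked_z_linearised:
  assumes b: "b \<in> res_index K"
  defines "A \<equiv> slr_affine_model md xh P"
  shows "stacked_z md P y xh b
      + (\<Sum>j\<in>{1..K}. \<Sum>l\<in>UNIV. stacked_z_partial A b j l * (x j - xh j) $ l)
    = stack (x 1 - am A) (\<lambda>k. x (Suc k) - (aF A k *v x k + ab A k))
        (\<lambda>k. y k - (aH A k *v x k + ac A k)) b"
proof -
  have ax: "(\<Sum>l\<in>UNIV. axis l 1 $ i * v $ l) = v $ i" for i and v :: "real^'n"
  proof -
    have "(\<Sum>l\<in>UNIV. axis l 1 $ i * v $ l) = (\<Sum>l\<in>UNIV. if i = l then v $ l else 0)"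
      by (intro sum.cong) (auto simp: axis_def)
    then show ?thesis by simp
  qed
  have pick: "(\<Sum>j\<in>{1..K}. \<Sum>l\<in>UNIV. (if j = k then f l else 0) * (x j - xh j) $ l)
      = (\<Sum>l\<in>UNIV. f l * (x k - xh k) $ l)" if "k \<in> {1..K}" for k and f :: "'n \<Rightarrow> real"
  proof -
    have "(\<Sum>j\<in>{1..K}. \<Sum>l\<in>UNIV. (if j = k then f l else 0) * (x j - xh j) $ l)
      = (\<Sum>j\<in>{1..K}. if j = k then \<Sum>l\<in>UNIV. f l * (x j - xh j) $ l else 0)"
      by (intro sum.cong) auto
    then show ?thesis using that by simp
  qed
  have mv: "(\<Sum>l\<in>UNIV. M $ i $ l * v $ l) = (M *v v) $ i" for M :: "real^'n^'q" and i v
    by (simp add: matrix_vector_mult_def)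
  show ?thesis
  proof (cases b)
    case (PriorRow i)
    have k: "1 \<in> {1..K}" using K by simp
    show ?thesis
      unfolding PriorRow stacked_z_partial.simps pick[OF k] ax
      by (simp add: A_def slr_affine_model_def)
  next
    case (DynRow k i)
    then have k: "k \<in> {1..K}" "Suc k \<in> {1..K}" using b by (auto simp: res_index_def)
    show ?thesis
      unfolding DynRow stacked_z_partial.simps left_diff_distrib sum_subtractf pick[OF k(1)] pick[OF k(2)] ax mv
      by (simp add: A_def slr_affine_model_def slr_offset_def vec.diff)
  next
    case (ObsRow k i)
    then have k: "k \<in> {1..K}" using b by (auto simp: res_index_def)
    show ?thesis
      unfolding ObsRow stacked_z_partial.simps mult_minus_left sum_negf pick[OF k] mv
      by (simp add: A_def slr_affine_model_def slr_offset_def vec.diff)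
  qed
qed

text \<open>Whitening is a fixed linear map and hence commutes with linearisation; the whitened
  linear residual is the whitened residual of the affine model.\<close>

lemma gn_objective_affine_cost:
  assumes S: "is_Sigma_inv_sqrt md K xh P S"
  shows "gn_objective md K xh P y S x = 1/2 * affine_cost (slr_affine_model md xh P) K y x"
proof -
  let ?I = "res_index K :: ('n, 'm) ridx set" and ?A = "slr_affine_model md xh P"
  let ?D = "\<lambda>b. \<Sum>j\<in>{1..K}. \<Sum>l\<in>UNIV. stacked_z_partial ?A b j l * (x j - xh j) $ l"
  have lin: "residual md K P y S xh a + (\<Sum>(j, l)\<in>{1..K} \<times> UNIV.
      jacobian_entry (residual md K P y S) xh a (j, l) * (x j - xh j) $ l)
    = (\<Sum>b\<in>?I. S b a * stack (x 1 - am ?A) (\<lambda>k. x (Suc k) - (aF ?A k *v x k + ab ?A k))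
        (\<lambda>k. y k - (aH ?A k *v x k + ac ?A k)) b)" for a
  proof -
    have "(\<Sum>(j, l)\<in>{1..K} \<times> UNIV. jacobian_entry (residual md K P y S) xh a (j, l) * (x j - xh j) $ l)
      = (\<Sum>q\<in>{1..K} \<times> UNIV. \<Sum>b\<in>?I. S b a * (stacked_z_partial ?A b (fst q) (snd q) * (x (fst q) - xh (fst q)) $ snd q))"
      by (simp add: jacobian_residual case_prod_unfold sum_distrib_right mult.assoc)
    also have "\<dots> = (\<Sum>b\<in>?I. \<Sum>q\<in>{1..K} \<times> UNIV. S b a * (stacked_z_partial ?A b (fst q) (snd q) * (x (fst q) - xh (fst q)) $ snd q))"
      by (rule sum.swap)
    also have "\<dots> = (\<Sum>b\<in>?I. S b a * ?D b)"
      by (simp add: sum_distrib_left sum.cartesian_product case_prod_unfold)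
    finally have D: "(\<Sum>(j, l)\<in>{1..K} \<times> UNIV. jacobian_entry (residual md K P y S) xh a (j, l) * (x j - xh j) $ l)
      = (\<Sum>b\<in>?I. S b a * ?D b)" .
    have "(\<Sum>b\<in>?I. S b a * stack (x 1 - am ?A) (\<lambda>k. x (Suc k) - (aF ?A k *v x k + ab ?A k))
        (\<lambda>k. y k - (aH ?A k *v x k + ac ?A k)) b)
      = (\<Sum>b\<in>?I. S b a * (stacked_z md P y xh b + ?D b))"
      by (intro sum.cong refl) (simp only: stacked_z_linearised)
    then show ?thesis
      unfolding D residual_def by (simp only: distrib_left sum.distrib)
  qed
  show ?thesis
    unfolding gn_objective_def lin sq_norm_whitened[OF S] affine_cost_def
    by (simp add: slr_affine_model_def)
qed

end

section \<open>Characteristic functions\<close>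

lemma integrable_mult_bounded:
  fixes f g :: "'a \<Rightarrow> real"
  assumes f: "integrable M f" and g [measurable]: "g \<in> borel_measurable M" and "\<And>w. \<bar>g w\<bar> \<le> 1"
  shows "integrable M (\<lambda>w. f w * g w)"
proof (rule Bochner_Integration.integrable_bound[OF f])
  have [measurable]: "f \<in> borel_measurable M" using f by auto
  show "(\<lambda>w. f w * g w) \<in> borel_measurable M" by measurable
  show "AE w in M. norm (f w * g w) \<le> norm (f w)"
    using assms(3) by (intro AE_I2) (simp add: abs_mult mult_left_le)
qed

text \<open>
  The positive and negative parts of \<open>W\<close> push forward along \<open>Z\<close> to finite measures with the same
  characteristic function.
\<close>

lemma weighted_char_zero:
  fixes W Z :: "'w \<Rightarrow> real"
  assumes W: "integrable M W" and Z [measurable]: "Z \<in> borel_measurable M"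
    and cos0: "\<And>t. (\<integral>w. W w * cos (t * Z w) \<partial>M) = 0"
    and sin0: "\<And>t. (\<integral>w. W w * sin (t * Z w) \<partial>M) = 0"
    and B [measurable]: "B \<in> sets borel"
  shows "(\<integral>w. W w * indicator B (Z w) \<partial>M) = 0"
proof -
  define Wp Wn where "Wp w = max 0 (W w)" and "Wn w = max 0 (- W w)" for w
  have [measurable]: "W \<in> borel_measurable M" using W by auto
  have int: "integrable M Wp" "integrable M Wn"
    unfolding Wp_def Wn_def using W by (auto intro!: integrable_max)
  have nonneg: "0 \<le> Wp w" "0 \<le> Wn w" and diff: "W w = Wp w - Wn w" for w
    by (auto simp: Wp_def Wn_def)
  have [measurable]: "Wp \<in> borel_measurable M" "Wn \<in> borel_measurable M" using int by auto
  define c where "c = (\<integral>w. Wp w \<partial>M)"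
  \<comment> \<open>The cosine hypothesis at \<open>t = 0\<close> makes the two parts equal in mass,
    so the same \<open>c\<close> normalises both.\<close>
  have "(\<integral>w. Wp w \<partial>M) - (\<integral>w. Wn w \<partial>M) = (\<integral>w. W w \<partial>M)"
    unfolding diff by (rule Bochner_Integration.integral_diff[symmetric]) (fact int)+
  also have "\<dots> = 0" using cos0[of 0] by simp
  finally have c': "c = (\<integral>w. Wn w \<partial>M)" by (simp add: c_def)
  show ?thesis
  \<comment> \<open>Levy uniqueness speaks about probability distributions, so mass zero, where
    normalisation fails, is treated apart.\<close>
  proof (cases "c = 0")
    case True
    then have "AE w in M. Wp w = 0" "AE w in M. Wn w = 0"
      using integral_nonneg_eq_0_iff_AE[OF int(1)] integral_nonneg_eq_0_iff_AE[OF int(2)] nonneg c'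
      by (auto simp: c_def)
    then have "AE w in M. W w * indicator B (Z w) = 0" by eventually_elim (simp add: diff)
    then show ?thesis by (rule integral_eq_zero_AE)
  next
    case False
    then have c: "c > 0" unfolding c_def using nonneg
      by (simp add: less_le integral_nonneg_AE)
    define N where "N V = distr (density M (\<lambda>w. ennreal (V w / c))) borel Z" for V
    have distN: "real_distribution (N V)"
      if V: "integrable M V" "\<And>w. 0 \<le> V w" "c = (\<integral>w. V w \<partial>M)" for V
    proof -
      have [measurable]: "V \<in> borel_measurable M" using V by auto
      have "prob_space (density M (\<lambda>w. ennreal (V w / c)))"
      proof
        have "emeasure (density M (\<lambda>w. ennreal (V w / c))) (space M) = (\<integral>\<^sup>+w. ennreal (V w / c) \<partial>M)"
          by (auto simp: emeasure_density intro!: nn_integral_cong)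
        also have "\<dots> = ennreal (\<integral>w. V w / c \<partial>M)"
          using V c by (intro nn_integral_eq_integral) auto
        also have "\<dots> = 1" using V(3) c by simp
        finally show "emeasure (density M (\<lambda>w. ennreal (V w / c)))
          (space (density M (\<lambda>w. ennreal (V w / c)))) = 1" by simp
      qed
      then show ?thesis unfolding N_def by (intro prob_space.real_distribution_distr) simp_all
    qed
    have intN: "(\<integral>x. \<phi> x \<partial>N V) = (\<integral>w. (V w / c) *\<^sub>R \<phi> (Z w) \<partial>M)"
      if V: "V \<in> borel_measurable M" "\<And>w. 0 \<le> V w" and \<phi>: "\<phi> \<in> borel_measurable borel"
      for V and \<phi> :: "real \<Rightarrow> 'b::{banach, second_countable_topology}"
    proof -
      note [measurable] = V(1) \<phi>
      have "(\<integral>x. \<phi> x \<partial>N V) = (\<integral>w. \<phi> (Z w) \<partial>density M (\<lambda>w. ennreal (V w / c)))"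
        unfolding N_def by (rule integral_distr) simp_all
      also have "\<dots> = (\<integral>w. (V w / c) *\<^sub>R \<phi> (Z w) \<partial>M)"
        using V c by (intro integral_density) auto
      finally show ?thesis .
    qed
    have bdd: "integrable M (\<lambda>w. (V w / c) *\<^sub>R \<phi> (Z w))"
      if V: "integrable M V" and \<phi>: "\<phi> \<in> borel_measurable borel" "\<And>x. norm (\<phi> x) \<le> 1"
      for V and \<phi> :: "real \<Rightarrow> 'b::{banach, second_countable_topology}"
    proof (rule Bochner_Integration.integrable_bound)
      show "integrable M (\<lambda>w. V w / c)" using V by simp
      show "(\<lambda>w. (V w / c) *\<^sub>R \<phi> (Z w)) \<in> borel_measurable M"
        using borel_measurable_integrable[OF V] \<phi>(1) by measurable
      have "\<bar>V w / c\<bar> * norm (\<phi> (Z w)) \<le> \<bar>V w / c\<bar> * 1" for w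
        by (intro mult_left_mono \<phi>(2)) simp
      then show "AE w in M. norm ((V w / c) *\<^sub>R \<phi> (Z w)) \<le> norm (V w / c)" by simp
    qed
    have euler: "exp (\<i> * (complex_of_real t * complex_of_real x))
        = complex_of_real (cos (t * x)) + \<i> * complex_of_real (sin (t * x))" for t x
      unfolding of_real_mult[symmetric] by (simp add: cis_conv_exp[symmetric] complex_eq_iff del: of_real_mult)
    have "char (N Wp) = char (N Wn)"
    proof
      fix t
      have m: "(\<lambda>x. iexp (t * x)) \<in> borel_measurable borel" by measurable
      have wc: "integrable M (\<lambda>w. W w * cos (t * Z w))" "integrable M (\<lambda>w. W w * sin (t * Z w))"
        by (auto intro!: integrable_mult_bounded[OF W])
      have wcc: "integrable M (\<lambda>w. complex_of_real (W w * cos (t * Z w)))"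
        "integrable M (\<lambda>w. \<i> * complex_of_real (W w * sin (t * Z w)))"
        by (intro integrable_mult_right integrable_of_real wc)+
      have "char (N Wp) t - char (N Wn) t
        = (\<integral>w. (Wp w / c) *\<^sub>R iexp (t * Z w) - (Wn w / c) *\<^sub>R iexp (t * Z w) \<partial>M)"
        unfolding char_def intN[OF borel_measurable_integrable[OF int(1)] nonneg(1) m]
          intN[OF borel_measurable_integrable[OF int(2)] nonneg(2) m]
        by (intro Bochner_Integration.integral_diff[symmetric] bdd[OF int(1) m] bdd[OF int(2) m]) auto
      also have "\<dots> = (\<integral>w. (complex_of_real (W w * cos (t * Z w))
          + \<i> * complex_of_real (W w * sin (t * Z w))) / complex_of_real c \<partial>M)"
        by (intro Bochner_Integration.integral_cong refl)
          (simp add: euler diff scaleR_conv_of_real diff_divide_distrib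
            add_divide_distrib algebra_simps)
      also have "\<dots> = (complex_of_real (\<integral>w. W w * cos (t * Z w) \<partial>M)
          + \<i> * complex_of_real (\<integral>w. W w * sin (t * Z w) \<partial>M)) / complex_of_real c"
        unfolding integral_complex_of_real[symmetric]
        by (subst integral_divide_zero, subst Bochner_Integration.integral_add[OF wcc]) simp
      also have "\<dots> = 0" by (simp only: cos0 sin0) simp
      finally show "char (N Wp) t = char (N Wn) t" by simp
    qed
    then have eq: "N Wp = N Wn"
      by (intro Levy_uniqueness distN int nonneg) (auto simp: c_def c' [unfolded c_def])
    have mB: "(indicator B :: real \<Rightarrow> real) \<in> borel_measurable borel" by measurable
    have "(\<integral>w. (Wp w / c) *\<^sub>R (indicator B (Z w) :: real) \<partial>M)
        = (\<integral>w. (Wn w / c) *\<^sub>R indicator B (Z w) \<partial>M)"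
      unfolding intN[OF borel_measurable_integrable[OF int(1)] nonneg(1) mB, symmetric]
        intN[OF borel_measurable_integrable[OF int(2)] nonneg(2) mB, symmetric] eq ..
    moreover have "(\<integral>w. (Wp w / c) *\<^sub>R (indicator B (Z w) :: real) \<partial>M)
        - (\<integral>w. (Wn w / c) *\<^sub>R indicator B (Z w) \<partial>M)
      = (\<integral>w. (Wp w / c) *\<^sub>R indicator B (Z w) - (Wn w / c) *\<^sub>R indicator B (Z w) \<partial>M)"
      by (intro Bochner_Integration.integral_diff[symmetric] bdd[OF int(1) mB] bdd[OF int(2) mB])
        (auto simp: indicator_def)
    moreover have "\<dots> = (\<integral>w. (W w * indicator B (Z w)) / c \<partial>M)"
      by (intro Bochner_Integration.integral_cong refl) (simp add: diff left_diff_distrib diff_divide_distrib)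
    ultimately show ?thesis using c by simp
  qed
qed

text \<open>Each induction step trades one frequency for one indicator: the weight \<open>D\<close>
  becomes \<open>D\<close> times the indicator of \<open>B r\<close> at \<open>Z r\<close>, hence
  \<open>D\<close> must be arbitrary. The free phase keeps the family of cosines closed under
  multiplication by \<open>cos (t * Z r w)\<close> and \<open>sin (t * Z r w)\<close>.\<close>

lemma weighted_char_zero_family:
  fixes D :: "'w \<Rightarrow> real" and Z :: "'l \<Rightarrow> 'w \<Rightarrow> real"
  assumes "finite L" "integrable M D" "\<And>l. l \<in> L \<Longrightarrow> Z l \<in> borel_measurable M"
    and "\<And>\<theta> u. (\<integral>w. D w * cos (\<theta> + (\<Sum>l\<in>L. u l * Z l w)) \<partial>M) = 0"
    and "\<And>l. l \<in> L \<Longrightarrow> B l \<in> sets borel"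
  shows "(\<integral>w. D w * (\<Prod>l\<in>L. indicator (B l) (Z l w)) \<partial>M) = 0"
  using assms
proof (induction L arbitrary: D rule: finite_induct)
  case empty
  show ?case using empty(3)[of 0] by simp
next
  case (insert r L)
  note D = insert.prems(1)
  have [measurable]: "Z r \<in> borel_measurable M" "B r \<in> sets borel"
    "\<And>l. l \<in> L \<Longrightarrow> Z l \<in> borel_measurable M" "D \<in> borel_measurable M"
    using insert.prems by auto
  let ?D = "\<lambda>w. D w * indicator (B r) (Z r w)"
  have "(\<integral>w. ?D w * (\<Prod>l\<in>L. indicator (B l) (Z l w)) \<partial>M) = 0"
  proof (rule insert.IH)
    show "integrable M ?D"
      by (rule integrable_mult_bounded[OF D]) (auto simp: indicator_def)
    fix \<theta> and u :: "'l \<Rightarrow> real"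
    let ?U = "\<lambda>w. \<Sum>l\<in>L. u l * Z l w"
    have u: "(\<Sum>l\<in>insert r L. (u(r := s)) l * Z l w) = s * Z r w + ?U w" for s w
      using insert.hyps by (auto intro!: sum.cong)
    have int: "integrable M (\<lambda>w. D w * cos (\<eta> + (s * Z r w + ?U w)))" for \<eta> s
      by (rule integrable_mult_bounded[OF D]) auto
    have zero: "(\<integral>w. D w * cos (\<eta> + (s * Z r w + ?U w)) \<partial>M) = 0" for \<eta> s
      using insert.prems(3)[of \<eta> "u(r := s)"] unfolding u .
    have "(\<integral>w. (D w * cos (\<theta> + ?U w)) * indicator (B r) (Z r w) \<partial>M) = 0"
    proof (rule weighted_char_zero)
      show "integrable M (\<lambda>w. D w * cos (\<theta> + ?U w))" using int[of \<theta> 0] by simp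
      fix t
      have cos_cos: "d * cos a * cos b = (d * cos (b + a) + d * cos (- b + a)) / 2"
        and cos_sin: "d * cos a * sin b = (d * sin (b + a) - d * sin (- b + a)) / 2" for a b d :: real
        by (simp_all add: cos_add sin_add cos_diff sin_diff algebra_simps)
      have "D w * cos (\<theta> + ?U w) * cos (t * Z r w)
        = (D w * cos (\<theta> + (t * Z r w + ?U w)) + D w * cos (\<theta> + (- t * Z r w + ?U w))) / 2" for w
        unfolding cos_cos by (simp add: add.left_commute)
      then show "(\<integral>w. D w * cos (\<theta> + ?U w) * cos (t * Z r w) \<partial>M) = 0"
        using Bochner_Integration.integral_add[OF int[of \<theta> t] int[of \<theta> "- t"]]
        by (simp only: zero integral_divide_zero) simp
      \<comment> \<open>The sine factor is reached by lowering the phase by a quarter period, which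
        the hypothesis allows.\<close>
      have shift: "cos (\<theta> - pi/2 + (v + ?U w)) = sin (v + (\<theta> + ?U w))" for v w
        using cos_diff[of "v + (\<theta> + ?U w)" "pi / 2"] by (simp add: algebra_simps)
      have "D w * cos (\<theta> + ?U w) * sin (t * Z r w)
        = (D w * cos (\<theta> - pi/2 + (t * Z r w + ?U w)) - D w * cos (\<theta> - pi/2 + (- t * Z r w + ?U w))) / 2" for w
        unfolding shift cos_sin by simp
      then show "(\<integral>w. D w * cos (\<theta> + ?U w) * sin (t * Z r w) \<partial>M) = 0"
        using Bochner_Integration.integral_diff[OF int[of "\<theta> - pi/2" t] int[of "\<theta> - pi/2" "- t"]]
        by (simp only: zero integral_divide_zero) simp
    qed simp_all
    then show "(\<integral>w. ?D w * cos (\<theta> + ?U w) \<partial>M) = 0" by (simp only: mult_ac)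
  qed (use insert.prems in auto)
  then show ?case using insert.hyps by (simp add: mult.assoc)
qed

text \<open>A pi-lambda argument for the signed measure with density \<open>D\<close>, started from
  the boxes in the coordinates \<open>Z l\<close>.\<close>

lemma integral_zero_sigma_sets:
  fixes D :: "'w \<Rightarrow> real" and Z :: "'l \<Rightarrow> 'w \<Rightarrow> real"
  assumes L: "finite L" and D: "integrable M D" and Z: "\<And>l. l \<in> L \<Longrightarrow> Z l \<in> borel_measurable M"
    and zero: "\<And>B. (\<And>l. l \<in> L \<Longrightarrow> B l \<in> sets borel) \<Longrightarrow>
      (\<integral>w. D w * (\<Prod>l\<in>L. indicator (B l) (Z l w)) \<partial>M) = 0"
    and E: "E \<in> sigma_sets (space M)
      {{w \<in> space M. \<forall>l\<in>L. Z l w \<in> B l} | B. \<forall>l\<in>L. B l \<in> sets borel}" (is "_ \<in> sigma_sets _ ?G")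
  shows "(\<integral>w. D w * indicator E w \<partial>M) = 0"
proof -
  have G: "?G \<subseteq> sets M"
  proof safe
    fix B assume B: "\<forall>l\<in>L. B l \<in> sets (borel :: real measure)"
    show "{w \<in> space M. \<forall>l\<in>L. Z l w \<in> B l} \<in> sets M"
      using L Z B by (intro sets.sets_Collect_finite_All) (auto simp: pred_def[symmetric] intro: measurable_sets)
  qed
  then have GM: "sigma_sets (space M) ?G \<subseteq> sets M" by (rule sets.sigma_sets_subset)
  have int: "integrable M (\<lambda>w. D w * indicator F w)" if "F \<in> sets M" for F
    using integrable_real_mult_indicator[OF that D] .
  have stable: "Int_stable ?G"
  proof (rule Int_stableI)
    fix a b assume "a \<in> ?G" "b \<in> ?G"
    then obtain A B where AB: "a = {w \<in> space M. \<forall>l\<in>L. Z l w \<in> A l}" "\<forall>l\<in>L. A l \<in> sets borel"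
      "b = {w \<in> space M. \<forall>l\<in>L. Z l w \<in> B l}" "\<forall>l\<in>L. B l \<in> sets borel" by auto
    have "a \<inter> b = {w \<in> space M. \<forall>l\<in>L. Z l w \<in> A l \<inter> B l}" unfolding AB by auto
    moreover have "\<forall>l\<in>L. A l \<inter> B l \<in> sets borel" using AB(2,4) by auto
    ultimately show "a \<inter> b \<in> ?G" by (intro CollectI exI[of _ "\<lambda>l. A l \<inter> B l"] conjI)
  qed
  have basic: "(\<integral>w. D w * indicator F w \<partial>M) = 0" if "F \<in> ?G" for F
  proof -
    from that obtain B where B: "F = {w \<in> space M. \<forall>l\<in>L. Z l w \<in> B l}" "\<forall>l\<in>L. B l \<in> sets borel"
      by auto
    have "(\<integral>w. D w * indicator F w \<partial>M) = (\<integral>w. D w * (\<Prod>l\<in>L. indicator (B l) (Z l w)) \<partial>M)"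
    proof (intro Bochner_Integration.integral_cong refl arg_cong2[where f = "(*)"])
      fix w assume "w \<in> space M"
      then show "indicator F w = (\<Prod>l\<in>L. indicator (B l) (Z l w) :: real)"
        using L unfolding B(1) by (auto simp: indicator_def prod_zero_iff)
    qed
    then show ?thesis using zero B by simp
  qed
  have Pow: "?G \<subseteq> Pow (space M)" by auto
  \<comment> \<open>The whole space is a box, so the total integral of \<open>D\<close> is zero; the
    complement step rests on this.\<close>
  have whole: "space M \<in> ?G" by (auto intro!: exI[of _ "\<lambda>_. UNIV"])
  show ?thesis
    using stable Pow E
  proof (induction rule: sigma_sets_induct_disjoint)
    case (basic A)
    then show ?case by (rule \<open>\<And>F. F \<in> ?G \<Longrightarrow> _\<close>)
  next
    case empty
    show ?case by simp
  next
    case (compl A)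
    have A: "A \<in> sets M" using compl(1) GM by auto
    have "(\<integral>w. D w * indicator (space M - A) w \<partial>M)
      = (\<integral>w. D w * indicator (space M) w - D w * indicator A w \<partial>M)"
      by (intro Bochner_Integration.integral_cong refl) (auto simp: indicator_def)
    also have "\<dots> = (\<integral>w. D w * indicator (space M) w \<partial>M) - (\<integral>w. D w * indicator A w \<partial>M)"
      using A by (intro Bochner_Integration.integral_diff int) auto
    finally show ?case using compl basic[OF whole] by simp
  next
    case (union A)
    have A: "range A \<subseteq> sets M" using union GM by blast
    then have U: "(\<Union>i. A i) \<in> sets M" by auto
    have "set_lebesgue_integral M (\<Union>i. A i) D = (\<Sum>i. set_lebesgue_integral M (A i) D)"
    proof (rule lebesgue_integral_countable_add)
      show "set_integrable M (\<Union>i. A i) D"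
        unfolding set_integrable_def by (intro integrable_mult_indicator U D)
    qed (use A union in \<open>auto simp: disjoint_family_on_def\<close>)
    moreover have "set_lebesgue_integral M F D = (\<integral>w. D w * indicator F w \<partial>M)" for F
      by (simp add: set_lebesgue_integral_def mult.commute)
    ultimately show ?case using union(3) by simp
  qed
qed

section \<open>Projections of Gaussian vectors, including degenerate ones\<close>

lemma gaussian_rv_char:
  assumes "gaussian_rv M X m P"
  shows "(\<integral>w. iexp (u \<bullet> X w) \<partial>M) = exp (\<i> * (u \<bullet> m) - (u \<bullet> (P *v u)) / 2)"
proof -
  have [measurable]: "X \<in> borel_measurable M" using assms by (simp add: gaussian_rv_def)
  have d: "distr M borel (\<lambda>w. u \<bullet> X w) = (if u \<bullet> (P *v u) = 0 then return borel (u \<bullet> m)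
         else density lborel (\<lambda>t. ennreal (normal_density (u \<bullet> m) (sqrt (u \<bullet> (P *v u))) t)))"
    using assms by (simp add: gaussian_rv_def)
  have nn: "0 \<le> u \<bullet> (P *v u)" using assms by (simp add: gaussian_rv_def psd_def)
  have "(\<integral>w. iexp (u \<bullet> X w) \<partial>M) = (\<integral>x. iexp x \<partial>distr M borel (\<lambda>w. u \<bullet> X w))"
    by (rule integral_distr[symmetric]) measurable
  also have "\<dots> = exp (\<i> * (u \<bullet> m) - (u \<bullet> (P *v u)) / 2)"
  proof (cases "u \<bullet> (P *v u) = 0")
    case True
    then show ?thesis unfolding d by (simp add: integral_return)
  next
    case False
    define s where "s = sqrt (u \<bullet> (P *v u))"
    have s: "s > 0" "s\<^sup>2 = u \<bullet> (P *v u)" using False nn by (auto simp: s_def)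
    interpret N: prob_space std_normal_distribution by (rule prob_space_normal_density) simp
    have "distributed std_normal_distribution lborel (\<lambda>x. x) std_normal_density"
      by (auto simp: distributed_def distr_id2)
    from N.normal_density_affine[OF this, of s "u \<bullet> m"] s
    have "distr std_normal_distribution lborel (\<lambda>x. u \<bullet> m + s * x) = density lborel (normal_density (u \<bullet> m) s)"
      by (simp add: distributed_def)
    then have "(\<integral>x. iexp x \<partial>density lborel (normal_density (u \<bullet> m) s))
      = (\<integral>x. iexp x \<partial>distr std_normal_distribution lborel (\<lambda>x. u \<bullet> m + s * x))" by simp
    also have "\<dots> = (\<integral>x. iexp (u \<bullet> m + s * x) \<partial>std_normal_distribution)"
      by (rule integral_distr) measurable
    also have "\<dots> = (\<integral>x. iexp (u \<bullet> m) * iexp (s * x) \<partial>std_normal_distribution)"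
      by (simp add: exp_add distrib_left)
    also have "\<dots> = iexp (u \<bullet> m) * char std_normal_distribution s"
      by (simp add: char_def)
    also have "char std_normal_distribution s = exp (- complex_of_real (u \<bullet> (P *v u)) / 2)"
      unfolding char_std_normal_distribution s(2) exp_of_real[symmetric] by simp
    also have "iexp (u \<bullet> m) * exp (- complex_of_real (u \<bullet> (P *v u)) / 2)
        = exp (\<i> * (u \<bullet> m) - (u \<bullet> (P *v u)) / 2)"
      by (simp add: mult_exp_exp)
    finally show ?thesis unfolding d using False by (simp add: s_def)
  qed
  finally show ?thesis .
qed

lemma gaussian_rv_integrable:
  assumes "prob_space M" "gaussian_rv M X m P"
  shows "integrable M (\<lambda>w. u \<bullet> X w)"
proof -
  interpret prob_space M by fact
  have [measurable]: "X \<in> borel_measurable M" using assms by (simp add: gaussian_rv_def)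
  have d: "distr M borel (\<lambda>w. u \<bullet> X w) = (if u \<bullet> (P *v u) = 0 then return borel (u \<bullet> m)
         else density lborel (\<lambda>t. ennreal (normal_density (u \<bullet> m) (sqrt (u \<bullet> (P *v u))) t)))"
    using assms by (simp add: gaussian_rv_def)
  have nn: "0 \<le> u \<bullet> (P *v u)" using assms by (simp add: gaussian_rv_def psd_def)
  have "integrable (distr M borel (\<lambda>w. u \<bullet> X w)) (\<lambda>x. x)"
  proof (cases "u \<bullet> (P *v u) = 0")
    case True
    then show ?thesis unfolding d by (simp add: integrable_iff_bounded nn_integral_return)
  next
    case False
    then show ?thesis unfolding d using nn
      by (subst if_not_P, simp) (subst integrable_density, auto intro!: integrable_normal_moment_nz_1)
  qed
  then show ?thesis by (simp add: integrable_distr_eq)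
qed

section \<open>Affine functionals of the noise\<close>

text \<open>Explicit coefficients over finitely many times, from which continuity, measurability and
  dependence on the coordinates \<open>1..K\<close> alone can all be read off.\<close>

definition meas_affine :: "nat \<Rightarrow> ((nat \<Rightarrow> real^'m) \<Rightarrow> real^'n) \<Rightarrow> bool" where
  "meas_affine K \<phi> \<longleftrightarrow> (\<exists>c M. \<forall>y. \<phi> y = c + (\<Sum>j\<in>{1..K}. M j *v y j))"

lemma meas_affineI: "(\<And>y. \<phi> y = c + (\<Sum>j\<in>{1..K}. M j *v y j)) \<Longrightarrow> meas_affine K \<phi>"
  unfolding meas_affine_def by blast

lemma meas_affine_const: "meas_affine K (\<lambda>y. c)"
  by (rule meas_affineI[of _ c "\<lambda>_. 0"]) simp

lemma meas_affine_coord: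
  assumes "k \<in> {1..K}"
  shows "meas_affine K (\<lambda>y. y k)"
proof (rule meas_affineI[of _ 0 "\<lambda>j. if j = k then mat 1 else 0"])
  fix y :: "nat \<Rightarrow> real^'m"
  have "(\<Sum>j\<in>{1..K}. (if j = k then mat 1 else 0) *v y j) = (\<Sum>j\<in>{1..K}. if j = k then y j else 0)"
    by (intro sum.cong) auto
  then show "y k = 0 + (\<Sum>j\<in>{1..K}. (if j = k then mat 1 else 0) *v y j)" using assms by simp
qed

lemma meas_affine_add:
  assumes "meas_affine K \<phi>" "meas_affine K \<psi>"
  shows "meas_affine K (\<lambda>y. \<phi> y + \<psi> y)"
proof -
  obtain c M d N where "\<And>y. \<phi> y = c + (\<Sum>j\<in>{1..K}. M j *v y j)" "\<And>y. \<psi> y = d + (\<Sum>j\<in>{1..K}. N j *v y j)"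
    using assms unfolding meas_affine_def by blast
  then show ?thesis
    by (intro meas_affineI[of _ "c + d" "\<lambda>j. M j + N j"])
      (simp add: matrix_vector_mult_add_rdistrib sum.distrib)
qed

lemma meas_affine_mult:
  fixes B :: "real^'n^'q"
  assumes "meas_affine K \<phi>"
  shows "meas_affine K (\<lambda>y. B *v \<phi> y)"
proof -
  obtain c M where "\<And>y. \<phi> y = c + (\<Sum>j\<in>{1..K}. M j *v y j)"
    using assms unfolding meas_affine_def by blast
  moreover have "B *v (\<Sum>j\<in>J. f j) = (\<Sum>j\<in>J. B *v f j)" for J and f :: "nat \<Rightarrow> real^'n"
    by (rule vec.sum)
  ultimately show ?thesis
    by (intro meas_affineI[of _ "B *v c" "\<lambda>j. B ** M j"]) (simp add: vec.add matrix_vector_mul_assoc)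
qed

lemma meas_affine_diff:
  fixes \<phi> :: "(nat \<Rightarrow> real^'m) \<Rightarrow> real^'n"
  assumes "meas_affine K \<phi>" "meas_affine K \<psi>"
  shows "meas_affine K (\<lambda>y. \<phi> y - \<psi> y)"
proof -
  have "(- mat 1) *v x = - x" for x :: "real^'n"
    by (simp add: vec_eq_iff matrix_vector_mult_def mat_def if_distrib[of uminus]
      if_distrib[of "\<lambda>r. r * _"] cong: if_cong)
  then show ?thesis
    using meas_affine_add[OF assms(1) meas_affine_mult[OF assms(2), of "- mat 1"]] by simp
qed

section \<open>Smoothed means as affine functions of the measurements\<close>

lemma kf_update_cov_cong: "snd p = snd p' \<Longrightarrow> snd (kf_update A y k p) = snd (kf_update A y' k p')"
  by (simp add: kf_update_def Let_def case_prod_unfold)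

text \<open>Covariances, and with them all gains, are independent of the data. The mean recursions
  therefore have constant coefficients and are affine in \<open>y\<close>.\<close>

lemma kf_pred_cov: "snd (kf_pred A y k) = snd (kf_pred A y' k)"
proof (induction k)
  case (Suc k)
  then show ?case
    using kf_update_cov_cong[OF Suc, where A = A and k = "Suc k" and y = y and y' = y'] by (simp add: kf_predict_def case_prod_unfold)
qed simp

lemma kf_filt_cov: "snd (kf_filt A y k) = snd (kf_filt A y' k)"
  unfolding kf_filt_def by (intro kf_update_cov_cong kf_pred_cov)

lemma rts_gain_cong: "rts_gain A y k = rts_gain A y' k"
  unfolding rts_gain_def kf_pred_cov[of A y k y'] kf_filt_cov[of A y k y'] ..

lemma meas_affine_update:
  assumes "k \<in> {1..K}" "meas_affine K (\<lambda>y. fst (p y))" "\<And>y y'. snd (p y) = snd (p y')"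
  shows "meas_affine K (\<lambda>y. fst (kf_update A y k (p y)))"
proof -
  \<comment> \<open>Evaluating at \<open>undefined\<close> merely names the common value of the
    data-independent covariance.\<close>
  define C where "C = snd (p undefined)"
  have C: "snd (p y) = C" for y unfolding C_def by (rule assms(3))
  show ?thesis
    unfolding kf_update_def Let_def case_prod_unfold fst_conv C
    by (intro meas_affine_add meas_affine_diff meas_affine_mult meas_affine_const meas_affine_coord assms)
qed

lemma meas_affine_kf_pred: "k < K \<Longrightarrow> meas_affine K (\<lambda>y. fst (kf_pred A y k))"
proof (induction k)
  case 0
  then show ?case by (simp add: meas_affine_const)
next
  case (Suc k)
  have "Suc k \<in> {1..K}" "meas_affine K (\<lambda>y. fst (kf_pred A y k))" using Suc by auto
  note u = meas_affine_update[OF this kf_pred_cov]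
  show ?case
    unfolding kf_pred.simps kf_predict_def case_prod_unfold fst_conv
    by (intro meas_affine_add[OF _ meas_affine_const] meas_affine_mult u)
qed

lemma meas_affine_kf_filt:
  assumes "k \<in> {1..K}"
  shows "meas_affine K (\<lambda>y. fst (kf_filt A y k))"
proof -
  have "meas_affine K (\<lambda>y. fst (kf_pred A y (k - 1)))"
    using assms by (intro meas_affine_kf_pred) auto
  from meas_affine_update[OF assms this kf_pred_cov] show ?thesis unfolding kf_filt_def .
qed

lemma meas_affine_rts_mean:
  assumes "k \<in> {1..K}"
  shows "meas_affine K (\<lambda>y. rts_mean A K y k)"
proof -
  have "k \<le> K" "1 \<le> k" using assms by auto
  then show ?thesis
  proof (induction k rule: inc_induct)
    case base
    then show ?case unfolding rts_mean_last by (intro meas_affine_kf_filt) simp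
  next
    case (step k)
    define G where "G = rts_gain A undefined k"
    have g: "rts_gain A y k = G" for y unfolding G_def by (rule rts_gain_cong)
    have "meas_affine K (\<lambda>y. fst (kf_filt A y k)
        + G *v (rts_mean A K y (Suc k) - fst (kf_pred A y k)))"
      using step by (intro meas_affine_add meas_affine_mult meas_affine_diff meas_affine_kf_filt
          meas_affine_kf_pred) auto
    then show ?case using rts_mean_step[of k K A] step by (simp add: g)
  qed
qed

text \<open>
  \<open>e 0\<close> is the deviation of \<open>x\<^sub>1\<close> from the prior mean and \<open>e k\<close>, for \<open>k \<ge> 1\<close>, the total noise in the step
  from \<open>k\<close> to \<open>k + 1\<close>; the state at time \<open>0\<close> is a dummy value.
\<close>

primrec trajectory :: "('n::finite, 'm::finite) affine_model \<Rightarrow> (nat \<Rightarrow> real^'n) \<Rightarrow> nat \<Rightarrow> real^'n" where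
  "trajectory A e 0 = 0"
| "trajectory A e (Suc k) =
     (if k = 0 then am A + e 0 else aF A k *v trajectory A e k + ab A k + e k)"

definition measurements :: "('n::finite, 'm::finite) affine_model \<Rightarrow> (nat \<Rightarrow> real^'n) \<Rightarrow>
    (nat \<Rightarrow> real^'m) \<Rightarrow> nat \<Rightarrow> real^'m" where
  "measurements A e v k = aH A k *v trajectory A e k + ac A k + v k"

definition state_cov :: "('n::finite, 'm::finite) affine_model \<Rightarrow> nat \<Rightarrow> real^'n^'n" where
  "state_cov A k = (if k = 0 then aP A else aQ A k + aOmega A k)"

definition obs_cov :: "('n::finite, 'm::finite) affine_model \<Rightarrow> nat \<Rightarrow> real^'m^'m" where
  "obs_cov A k = aR A k + aGamma A k"

definition noise_cost :: "('n::finite, 'm::finite) affine_model \<Rightarrow> nat \<Rightarrow> (nat \<Rightarrow> real^'n) \<Rightarrow>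
    (nat \<Rightarrow> real^'m) \<Rightarrow> real" where
  "noise_cost A K e v = (\<Sum>k<K. mahal (state_cov A k) (e k)) + (\<Sum>k\<in>{1..K}. mahal (obs_cov A k) (v k))"

definition noise_form :: "nat \<Rightarrow> real \<Rightarrow> (nat \<Rightarrow> real^'n) \<Rightarrow> (nat \<Rightarrow> real^'m) \<Rightarrow>
    (nat \<Rightarrow> real^'n) \<Rightarrow> (nat \<Rightarrow> real^'m) \<Rightarrow> real" where
  "noise_form K \<mu> \<alpha> \<beta> e v = \<mu> + (\<Sum>k<K. \<alpha> k \<bullet> e k) + (\<Sum>k\<in>{1..K}. \<beta> k \<bullet> v k)"

definition noise_var :: "('n::finite, 'm::finite) affine_model \<Rightarrow> nat \<Rightarrow> (nat \<Rightarrow> real^'n) \<Rightarrow>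
    (nat \<Rightarrow> real^'m) \<Rightarrow> real" where
  "noise_var A K \<alpha> \<beta> =
     (\<Sum>k<K. \<alpha> k \<bullet> (state_cov A k *v \<alpha> k)) + (\<Sum>k\<in>{1..K}. \<beta> k \<bullet> (obs_cov A k *v \<beta> k))"

definition noise_affine :: "nat \<Rightarrow> ((nat \<Rightarrow> real^'n) \<Rightarrow> (nat \<Rightarrow> real^'m) \<Rightarrow> real) \<Rightarrow> bool" where
  "noise_affine K \<phi> \<longleftrightarrow> (\<exists>\<mu> \<alpha> \<beta>. \<phi> = noise_form K \<mu> \<alpha> \<beta>)"

lemma lessThan_split_first:
  fixes K :: nat
  shows "1 \<le> K \<Longrightarrow> (\<Sum>k<K. f k) = f 0 + (\<Sum>k\<in>{1..<K}. f k :: real)"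
proof -
  assume "1 \<le> K"
  then have "{..<K} = insert 0 {1..<K}" by auto
  then show ?thesis by simp
qed

text \<open>Change of variables from states to noises: along a trajectory the residuals of the model
  are the noises that drive it.\<close>

lemma affine_cost_trajectory:
  assumes "1 \<le> K"
  shows "affine_cost A K (measurements A e v) (trajectory A e) = noise_cost A K e v"
proof -
  have "(\<Sum>k\<in>{1..<K}. mahal (aQ A k + aOmega A k)
      (trajectory A e (Suc k) - (aF A k *v trajectory A e k + ab A k)))
    = (\<Sum>k\<in>{1..<K}. mahal (state_cov A k) (e k))"
    by (intro sum.cong) (auto simp: state_cov_def)
  then show ?thesis
    unfolding affine_cost_def noise_cost_def lessThan_split_first[OF assms] measurements_def
    by (simp add: state_cov_def obs_cov_def)
qed

section \<open>Closure properties of affine noise functionals\<close>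

lemma noise_affineI: "(\<And>e v. \<phi> e v = noise_form K \<mu> \<alpha> \<beta> e v) \<Longrightarrow> noise_affine K \<phi>"
  unfolding noise_affine_def by blast

lemma noise_affine_const: "noise_affine K (\<lambda>e v. c)"
  by (rule noise_affineI[of _ _ c "\<lambda>_. 0" "\<lambda>_. 0"]) (simp add: noise_form_def)

lemma noise_affine_add:
  assumes "noise_affine K \<phi>" "noise_affine K \<psi>"
  shows "noise_affine K (\<lambda>e v. \<phi> e v + \<psi> e v)"
proof -
  obtain \<mu> \<alpha> \<beta> \<mu>' \<alpha>' \<beta>' where "\<phi> = noise_form K \<mu> \<alpha> \<beta>" "\<psi> = noise_form K \<mu>' \<alpha>' \<beta>'"
    using assms unfolding noise_affine_def by blast
  then show ?thesis
    by (intro noise_affineI[of _ _ "\<mu> + \<mu>'" "\<lambda>k. \<alpha> k + \<alpha>' k" "\<lambda>k. \<beta> k + \<beta>' k"])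
      (simp add: noise_form_def inner_add_left sum.distrib)
qed

lemma noise_affine_scale:
  assumes "noise_affine K \<phi>"
  shows "noise_affine K (\<lambda>e v. c * \<phi> e v)"
proof -
  obtain \<mu> \<alpha> \<beta> where "\<phi> = noise_form K \<mu> \<alpha> \<beta>"
    using assms unfolding noise_affine_def by blast
  then show ?thesis
    by (intro noise_affineI[of _ _ "c * \<mu>" "\<lambda>k. c *\<^sub>R \<alpha> k" "\<lambda>k. c *\<^sub>R \<beta> k"])
      (simp add: noise_form_def distrib_left sum_distrib_left)
qed

lemma noise_affine_diff:
  "noise_affine K \<phi> \<Longrightarrow> noise_affine K \<psi> \<Longrightarrow> noise_affine K (\<lambda>e v. \<phi> e v - \<psi> e v)"
  using noise_affine_add[OF _ noise_affine_scale[of K \<psi> "- 1"]] by simp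

lemma noise_affine_sum:
  "(\<And>l. l \<in> L \<Longrightarrow> noise_affine K (\<phi> l)) \<Longrightarrow> noise_affine K (\<lambda>e v. \<Sum>l\<in>L. \<phi> l e v)"
  by (induction L rule: infinite_finite_induct) (simp_all add: noise_affine_const noise_affine_add)

lemma noise_affine_state:
  assumes "k < K"
  shows "noise_affine K (\<lambda>e v. u \<bullet> e k)"
proof (rule noise_affineI[of _ _ 0 "\<lambda>j. if j = k then u else 0" "\<lambda>_. 0"])
  fix e :: "nat \<Rightarrow> real^'a" and v :: "nat \<Rightarrow> real^'b"
  have "(\<Sum>j<K. (if j = k then u else 0) \<bullet> e j) = (\<Sum>j<K. if j = k then u \<bullet> e j else 0)"
    by (intro sum.cong) auto
  then show "u \<bullet> e k = noise_form K 0 (\<lambda>j. if j = k then u else 0) (\<lambda>_. 0) e v"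
    using assms by (simp add: noise_form_def)
qed

lemma noise_affine_obs:
  assumes "k \<in> {1..K}"
  shows "noise_affine K (\<lambda>e v. u \<bullet> v k)"
proof (rule noise_affineI[of _ _ 0 "\<lambda>_. 0" "\<lambda>j. if j = k then u else 0"])
  fix e :: "nat \<Rightarrow> real^'a" and v :: "nat \<Rightarrow> real^'b"
  have "(\<Sum>j\<in>{1..K}. (if j = k then u else 0) \<bullet> v j) = (\<Sum>j\<in>{1..K}. if j = k then u \<bullet> v j else 0)"
    by (intro sum.cong) auto
  then show "u \<bullet> v k = noise_form K 0 (\<lambda>_. 0) (\<lambda>j. if j = k then u else 0) e v"
    using assms by (simp add: noise_form_def)
qed

lemma noise_affine_trajectory:
  "k \<in> {1..K} \<Longrightarrow> noise_affine K (\<lambda>e v. u \<bullet> trajectory A e k)"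
\<comment> \<open>The direction is generalised because each transition matrix is moved onto it as a
  transpose.\<close>
proof (induction k arbitrary: u)
  case (Suc k)
  then show ?case
    by (cases "k = 0")
      (auto simp: inner_add_right inner_transpose_matrix_vector[symmetric]
        simp del: transpose_matrix_vector
        intro!: noise_affine_add noise_affine_const noise_affine_state)
qed simp

lemma noise_affine_measurements:
  assumes "k \<in> {1..K}"
  shows "noise_affine K (\<lambda>e v. u \<bullet> measurements A e v k)"
  using noise_affine_trajectory[OF assms] assms
  by (auto simp: measurements_def inner_add_right inner_transpose_matrix_vector[symmetric]
      simp del: transpose_matrix_vector
      intro!: noise_affine_add noise_affine_const noise_affine_obs)

lemma noise_affine_meas_affine:
  assumes "meas_affine K \<phi>"
  shows "noise_affine K (\<lambda>e v. u \<bullet> \<phi> (measurements A e v))"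
proof -
  obtain c M where "\<And>y. \<phi> y = c + (\<Sum>j\<in>{1..K}. M j *v y j)"
    using assms unfolding meas_affine_def by blast
  then show ?thesis
    by (auto simp: inner_add_right inner_sum_right inner_transpose_matrix_vector[symmetric]
        simp del: transpose_matrix_vector
        intro!: noise_affine_add noise_affine_const noise_affine_sum noise_affine_measurements)
qed

text \<open>Convex conjugation of a quadratic form: the gap is the square
  \<open>mahal S (e - S *v a)\<close>, so the maximum is attained at
  \<open>e = S *v a\<close>.\<close>

lemma mahal_dual:
  assumes "spd S"
  shows "2 * (a \<bullet> e) - mahal S e \<le> a \<bullet> (S *v a)"
    and "2 * (a \<bullet> (S *v a)) - mahal S (S *v a) = a \<bullet> (S *v a)"
proof -
  have "mahal S (e - S *v a) = mahal S e - 2 * (a \<bullet> e) + a \<bullet> (S *v a)"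
    using spd_inv_inner_commute[OF assms, of e "S *v a"] spd_inner_commute[OF assms, of a a]
    by (simp add: mahal_def vec.diff inner_diff_left inner_diff_right spd_inverse[OF assms] inner_commute[of _ a]
        spd_inner_commute[OF assms])
  then show "2 * (a \<bullet> e) - mahal S e \<le> a \<bullet> (S *v a)"
    using mahal_nonneg[OF assms, of "e - S *v a"] by linarith
  show "2 * (a \<bullet> (S *v a)) - mahal S (S *v a) = a \<bullet> (S *v a)"
    by (simp add: mahal_def spd_inverse[OF assms] inner_commute[of a])
qed

context regular_affine_model
begin

lemma spd_state_cov: "k < K \<Longrightarrow> spd (state_cov A k)"
  using spd_prior spd_dyn[of k] by (auto simp: state_cov_def)

lemma spd_obs_cov: "k \<in> {1..K} \<Longrightarrow> spd (obs_cov A k)"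
  unfolding obs_cov_def by (rule spd_obs)

text \<open>
  Mean and variance of a functional enter the maximum of \<open>2 \<phi> - cost\<close> as \<open>2 \<mu> + var\<close>, so a bijection of the
  noise space that preserves the cost and the mean preserves the variance.
\<close>

lemma noise_dual_le:
  "2 * noise_form K \<mu> \<alpha> \<beta> e v - noise_cost A K e v \<le> 2 * \<mu> + noise_var A K \<alpha> \<beta>"
proof -
  have "(\<Sum>k<K. 2 * (\<alpha> k \<bullet> e k) - mahal (state_cov A k) (e k)) \<le> (\<Sum>k<K. \<alpha> k \<bullet> (state_cov A k *v \<alpha> k))"
    by (intro sum_mono mahal_dual spd_state_cov) auto
  moreover have "(\<Sum>k\<in>{1..K}. 2 * (\<beta> k \<bullet> v k) - mahal (obs_cov A k) (v k))
      \<le> (\<Sum>k\<in>{1..K}. \<beta> k \<bullet> (obs_cov A k *v \<beta> k))"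
    by (intro sum_mono mahal_dual spd_obs_cov)
  ultimately show ?thesis
    by (simp add: noise_form_def noise_cost_def noise_var_def sum_subtractf sum_distrib_left[symmetric])
qed

lemma noise_dual_attained:
  "2 * noise_form K \<mu> \<alpha> \<beta> (\<lambda>k. state_cov A k *v \<alpha> k) (\<lambda>k. obs_cov A k *v \<beta> k)
    - noise_cost A K (\<lambda>k. state_cov A k *v \<alpha> k) (\<lambda>k. obs_cov A k *v \<beta> k)
    = 2 * \<mu> + noise_var A K \<alpha> \<beta>"
proof -
  have "(\<Sum>k<K. 2 * (\<alpha> k \<bullet> (state_cov A k *v \<alpha> k)) - mahal (state_cov A k) (state_cov A k *v \<alpha> k))
      = (\<Sum>k<K. \<alpha> k \<bullet> (state_cov A k *v \<alpha> k))"
    by (intro sum.cong refl mahal_dual(2) spd_state_cov) auto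
  moreover have "(\<Sum>k\<in>{1..K}. 2 * (\<beta> k \<bullet> (obs_cov A k *v \<beta> k)) - mahal (obs_cov A k) (obs_cov A k *v \<beta> k))
      = (\<Sum>k\<in>{1..K}. \<beta> k \<bullet> (obs_cov A k *v \<beta> k))"
    by (intro sum.cong refl mahal_dual(2) spd_obs_cov)
  ultimately show ?thesis
    by (simp add: noise_form_def noise_cost_def noise_var_def sum_subtractf sum_distrib_left[symmetric])
qed

text \<open>The maximiser for the first functional is sent to a point at which the second functional
  has the same value and the cost is the same, so the second maximum is at least as large.\<close>

lemma noise_var_le:
  assumes "\<And>e v. \<exists>e' v'. noise_form K \<mu>' \<alpha>' \<beta>' e' v' = noise_form K \<mu> \<alpha> \<beta> e v
      \<and> noise_cost A K e' v' = noise_cost A K e v"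
  shows "2 * \<mu> + noise_var A K \<alpha> \<beta> \<le> 2 * \<mu>' + noise_var A K \<alpha>' \<beta>'"
  using assms[of "\<lambda>k. state_cov A k *v \<alpha> k" "\<lambda>k. obs_cov A k *v \<beta> k"]
    noise_dual_attained[of \<mu> \<alpha> \<beta>] noise_dual_le[of \<mu>' \<alpha>' \<beta>'] by metis

text \<open>Any state sequence together with any data is produced by exactly fitting noises; hence a
  reflection of the states that leaves the data alone lifts to the noise space.\<close>

lemma reflect_noise:
  obtains e' v' where "\<And>k. k \<ge> 1 \<Longrightarrow>
      trajectory A e' k = 2 *\<^sub>R rts_mean A K (measurements A e v) k - trajectory A e k"
    and "measurements A e' v' = measurements A e v"
    and "noise_cost A K e' v' = noise_cost A K e v"
proof -
  define y where "y = measurements A e v"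
  define x where "x k = 2 *\<^sub>R rts_mean A K y k - trajectory A e k" for k
  \<comment> \<open>The process noise is solved from the reflected states, and \<open>v'\<close>
    then absorbs the rest of the unchanged measurements.\<close>
  define e' where "e' k = (if k = 0 then x 1 - am A else x (Suc k) - (aF A k *v x k + ab A k))" for k
  define v' where "v' k = y k - (aH A k *v trajectory A e' k + ac A k)" for k
  have t: "trajectory A e' (Suc k) = x (Suc k)" for k
    by (induction k) (simp_all add: e'_def)
  then have t': "trajectory A e' k = x k" if "k \<ge> 1" for k using that by (cases k) auto
  have m: "measurements A e' v' = y"
    by (simp add: fun_eq_iff measurements_def v'_def)
  have "noise_cost A K e' v' = affine_cost A K y (trajectory A e')"
    using affine_cost_trajectory[OF K, of A e' v'] by (simp add: m)
  also have "\<dots> = affine_cost A K y x"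
    \<comment> \<open>\<open>x\<close> and the trajectory of \<open>e'\<close> may differ at the
      dummy time 0, which the cost does not read.\<close>
    using K unfolding affine_cost_def by (simp add: t t' del: trajectory.simps cong: sum.cong_simp)
  also have "\<dots> = affine_cost A K y (trajectory A e)"
    unfolding x_def by (rule affine_cost_reflect)
  also have "\<dots> = noise_cost A K e v"
    unfolding y_def by (rule affine_cost_trajectory[OF K])
  finally have cost: "noise_cost A K e' v' = noise_cost A K e v" .
  show thesis
  proof (rule that)
    show "trajectory A e' k = 2 *\<^sub>R rts_mean A K (measurements A e v) k - trajectory A e k"
      if "k \<ge> 1" for k
      using t'[OF that] by (simp add: x_def y_def)
    show "measurements A e' v' = measurements A e v" unfolding m y_def ..
  qed (rule cost)
qed

text \<open>The noise-free trajectory has cost zero for its own measurements, so it is the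
  minimiser. The smoothing error therefore vanishes at zero noise, which means that it has no
  constant term.\<close>

lemma rts_mean_noise_free:
  assumes "k \<in> {1..K}"
  shows "trajectory A (\<lambda>_. 0) k = rts_mean A K (measurements A (\<lambda>_. 0) (\<lambda>_. 0)) k"
proof -
  let ?y = "measurements A (\<lambda>_. 0) (\<lambda>_. 0)"
  have pos: "0 \<le> affine_cost A K ?y x" for x
    unfolding affine_cost_def
    by (intro add_nonneg_nonneg sum_nonneg mahal_nonneg spd_prior spd_dyn spd_obs)
  have "affine_cost A K ?y (trajectory A (\<lambda>_. 0)) = 0"
    unfolding affine_cost_trajectory[OF K] by (simp add: noise_cost_def mahal_def)
  then have "\<forall>x'. affine_cost A K ?y (trajectory A (\<lambda>_. 0)) \<le> affine_cost A K ?y x'"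
    using pos by simp
  then show ?thesis using assms unfolding affine_cost_minimiser_iff by blast
qed

text \<open>
  Reflecting the states about the smoothed means fixes the measurements, preserves the noise cost and
  reverses the sign of the smoothing error \<open>D\<close>.  The duality above turns this into equality of variances.
\<close>

lemma error_functional_symmetric:
  fixes u :: "real^'n" and s :: real
  assumes k: "k \<in> {1..K}" and U: "U = (\<lambda>e v. g (measurements A e v))" and aff: "noise_affine K U"
  defines "D \<equiv> \<lambda>e v. u \<bullet> (trajectory A e k - rts_mean A K (measurements A e v) k)"
  obtains \<mu> \<alpha> \<beta> \<alpha>' \<beta>' where "(\<lambda>e v. U e v + s * D e v) = noise_form K \<mu> \<alpha> \<beta>"
    and "(\<lambda>e v. U e v - s * D e v) = noise_form K \<mu> \<alpha>' \<beta>'"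
    and "noise_var A K \<alpha> \<beta> = noise_var A K \<alpha>' \<beta>'"
proof -
  have D: "noise_affine K D"
    unfolding D_def inner_diff_right
    by (intro noise_affine_diff noise_affine_trajectory noise_affine_meas_affine meas_affine_rts_mean k)
  have "noise_affine K (\<lambda>e v. U e v + s * D e v)" "noise_affine K (\<lambda>e v. U e v - s * D e v)"
    by (intro noise_affine_add noise_affine_diff noise_affine_scale aff D)+
  then obtain \<mu> \<alpha> \<beta> \<mu>' \<alpha>' \<beta>' where f: "(\<lambda>e v. U e v + s * D e v) = noise_form K \<mu> \<alpha> \<beta>"
    "(\<lambda>e v. U e v - s * D e v) = noise_form K \<mu>' \<alpha>' \<beta>'"
    unfolding noise_affine_def by blast
  have D0: "D (\<lambda>_. 0) (\<lambda>_. 0) = 0" by (simp add: D_def rts_mean_noise_free[OF k])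
  \<comment> \<open>The constant term is the value at zero noise, where the error functional
    vanishes; the two combinations thus share their mean.\<close>
  have \<mu>: "\<mu>' = \<mu>"
    using fun_cong[OF fun_cong[OF f(1)], of "\<lambda>_. 0" "\<lambda>_. 0"]
      fun_cong[OF fun_cong[OF f(2)], of "\<lambda>_. 0" "\<lambda>_. 0"]
    by (simp add: D0 noise_form_def)
  have reflect: "\<exists>e' v'. U e' v' = U e v \<and> D e' v' = - D e v \<and> noise_cost A K e' v' = noise_cost A K e v" for e v
  proof -
    obtain e' v' where r: "\<And>k. k \<ge> 1 \<Longrightarrow>
        trajectory A e' k = 2 *\<^sub>R rts_mean A K (measurements A e v) k - trajectory A e k"
      "measurements A e' v' = measurements A e v" "noise_cost A K e' v' = noise_cost A K e v"
      using reflect_noise by blast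
    have "D e' v' = - D e v"
      unfolding D_def r(2) using r(1)[of k] k by (simp add: inner_diff_right)
    then show ?thesis using r(2,3) unfolding U by metis
  qed
  have fe: "noise_form K \<mu> \<alpha> \<beta> e v = U e v + s * D e v"
    "noise_form K \<mu>' \<alpha>' \<beta>' e v = U e v - s * D e v" for e v
    unfolding f[symmetric] by (rule refl)+
  have "2 * \<mu> + noise_var A K \<alpha> \<beta> \<le> 2 * \<mu>' + noise_var A K \<alpha>' \<beta>'"
  proof (rule noise_var_le)
    fix e v
    obtain e' v' where "U e' v' = U e v" "D e' v' = - D e v" "noise_cost A K e' v' = noise_cost A K e v"
      using reflect by blast
    then show "\<exists>e' v'. noise_form K \<mu>' \<alpha>' \<beta>' e' v' = noise_form K \<mu> \<alpha> \<beta> e v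
        \<and> noise_cost A K e' v' = noise_cost A K e v"
      by (intro exI[of _ e'] exI[of _ v']) (simp add: fe)
  qed
  moreover have "2 * \<mu>' + noise_var A K \<alpha>' \<beta>' \<le> 2 * \<mu> + noise_var A K \<alpha> \<beta>"
  proof (rule noise_var_le)
    fix e v
    obtain e' v' where "U e' v' = U e v" "D e' v' = - D e v" "noise_cost A K e' v' = noise_cost A K e v"
      using reflect by blast
    then show "\<exists>e' v'. noise_form K \<mu> \<alpha> \<beta> e' v' = noise_form K \<mu>' \<alpha>' \<beta>' e v
        \<and> noise_cost A K e' v' = noise_cost A K e v"
      by (intro exI[of _ e'] exI[of _ v']) (simp add: fe)
  qed
  ultimately show thesis using f \<mu> that by auto
qed

end

section \<open>Realisations of the affine model\<close>

lemma realised_prob_space: "realises A K M X Y om q ga r \<Longrightarrow> prob_space M"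
  by (simp add: realises_def)

definition sources :: "nat \<Rightarrow> source set" where
  "sources K = {Initial} \<union> DynLin ` {1..<K} \<union> DynNoise ` {1..<K} \<union> ObsLin ` {1..K} \<union> ObsNoise ` {1..K}"

lemma finite_sources [simp]: "finite (sources K)"
  by (simp add: sources_def)

lemma sum_sources:
  fixes f :: "source \<Rightarrow> 'c::comm_monoid_add"
  shows "(\<Sum>s\<in>sources K. f s) = f Initial + ((\<Sum>k\<in>{1..<K}. f (DynLin k)) + (\<Sum>k\<in>{1..<K}. f (DynNoise k)))
    + ((\<Sum>k\<in>{1..K}. f (ObsLin k)) + (\<Sum>k\<in>{1..K}. f (ObsNoise k)))"
proof -
  have "(\<Sum>s\<in>sources K. f s) = f Initial + sum f (DynLin ` {1..<K}) + sum f (DynNoise ` {1..<K})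
      + sum f (ObsLin ` {1..K}) + sum f (ObsNoise ` {1..K})"
    unfolding sources_def by (subst sum.union_disjoint, force, force, force)+ simp
  then show ?thesis
    by (simp add: sum.reindex inj_on_def add.assoc)
qed

locale realised_affine_model = regular_affine_model A K + prob_space M
  for A :: "('n::finite, 'm::finite) affine_model" and K :: nat and M :: "'w measure" +
  fixes X :: "nat \<Rightarrow> 'w \<Rightarrow> real^'n" and Y :: "nat \<Rightarrow> 'w \<Rightarrow> real^'m"
    and om q :: "nat \<Rightarrow> 'w \<Rightarrow> real^'n" and ga r :: "nat \<Rightarrow> 'w \<Rightarrow> real^'m"
  assumes realises: "realises A K M X Y om q ga r"
begin

lemma gaussian:
  "gaussian_rv M (X 1) (am A) (aP A)"
  "k \<in> {1..<K} \<Longrightarrow> gaussian_rv M (om k) 0 (aOmega A k)"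
  "k \<in> {1..<K} \<Longrightarrow> gaussian_rv M (q k) 0 (aQ A k)"
  "k \<in> {1..K} \<Longrightarrow> gaussian_rv M (ga k) 0 (aGamma A k)"
  "k \<in> {1..K} \<Longrightarrow> gaussian_rv M (r k) 0 (aR A k)"
  using realises by (auto simp: realises_def)

lemma borel_measurable_sources [measurable]:
  "X (Suc 0) \<in> borel_measurable M"
  "k \<in> {1..<K} \<Longrightarrow> om k \<in> borel_measurable M"
  "k \<in> {1..<K} \<Longrightarrow> q k \<in> borel_measurable M"
  "k \<in> {1..K} \<Longrightarrow> ga k \<in> borel_measurable M"
  "k \<in> {1..K} \<Longrightarrow> r k \<in> borel_measurable M"
  using gaussian by (auto simp: gaussian_rv_def)

definition state_noise :: "'w \<Rightarrow> nat \<Rightarrow> real^'n" where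
  "state_noise w k = (if k = 0 then X 1 w - am A else om k w + q k w)"

definition obs_noise :: "'w \<Rightarrow> nat \<Rightarrow> real^'m" where
  "obs_noise w k = ga k w + r k w"

lemma state_trajectory:
  assumes "w \<in> space M"
  shows "k \<in> {1..K} \<Longrightarrow> X k w = trajectory A (state_noise w) k"
proof (induction k)
  case (Suc k)
  show ?case
  proof (cases "k = 0")
    case False
    then have "k \<in> {1..<K}" using Suc.prems by auto
    then have "X (Suc k) w = aF A k *v X k w + ab A k + om k w + q k w"
      using realises assms by (auto simp: realises_def)
    then show ?thesis using Suc False by (simp add: state_noise_def)
  qed (simp add: state_noise_def)
qed simp

lemma observed_measurements:
  assumes "w \<in> space M" "k \<in> {1..K}"
  shows "Y k w = measurements A (state_noise w) (obs_noise w) k"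
proof -
  have "Y k w = aH A k *v X k w + ac A k + ga k w + r k w"
    using realises assms by (auto simp: realises_def)
  then show ?thesis
    using state_trajectory[OF assms] by (simp add: measurements_def obs_noise_def)
qed

text \<open>The summand of a noise functional due to one independent source. \<open>Initial\<close>
  uses the uncentred first state, so the prior mean is corrected in the constant of
  \<open>noise_form_source_parts\<close>.\<close>

definition source_part :: "(nat \<Rightarrow> real^'n) \<Rightarrow> (nat \<Rightarrow> real^'m) \<Rightarrow> source \<Rightarrow> 'w \<Rightarrow> real" where
  "source_part \<alpha> \<beta> s w = (case s of Initial \<Rightarrow> \<alpha> 0 \<bullet> X 1 w | DynLin k \<Rightarrow> \<alpha> k \<bullet> om k w
     | DynNoise k \<Rightarrow> \<alpha> k \<bullet> q k w | ObsLin k \<Rightarrow> \<beta> k \<bullet> ga k w | ObsNoise k \<Rightarrow> \<beta> k \<bullet> r k w)"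

lemma borel_measurable_source_part:
  "s \<in> sources K \<Longrightarrow> source_part \<alpha> \<beta> s \<in> borel_measurable M"
  unfolding source_part_def[abs_def] sources_def by auto

lemma noise_form_source_parts:
  "noise_form K \<mu> \<alpha> \<beta> (state_noise w) (obs_noise w)
    = (\<mu> - \<alpha> 0 \<bullet> am A) + (\<Sum>s\<in>sources K. source_part \<alpha> \<beta> s w)"
proof -
  have "(\<Sum>k\<in>{1..<K}. \<alpha> k \<bullet> state_noise w k) = (\<Sum>k\<in>{1..<K}. \<alpha> k \<bullet> om k w + \<alpha> k \<bullet> q k w)"
    by (intro sum.cong) (auto simp: state_noise_def inner_add_right)
  then show ?thesis
    unfolding noise_form_def lessThan_split_first[OF K] sum_sources source_part_def
    by (simp add: state_noise_def obs_noise_def inner_add_right inner_diff_right sum.distrib)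
qed

lemma indep_source_parts: "indep_vars (\<lambda>_. borel) (source_part \<alpha> \<beta>) (sources K)"
  unfolding indep_vars_def2
proof (intro conjI ballI)
  fix s assume "s \<in> sources K"
  then show "random_variable borel (source_part \<alpha> \<beta> s)" by (rule borel_measurable_source_part)
next
  have "indep_sets
       (\<lambda>s. case s of
            Initial \<Rightarrow> sets (vimage_algebra (space M) (X 1) borel)
          | DynLin k \<Rightarrow> sets (vimage_algebra (space M) (om k) borel)
          | DynNoise k \<Rightarrow> sets (vimage_algebra (space M) (q k) borel)
          | ObsLin k \<Rightarrow> sets (vimage_algebra (space M) (ga k) borel)
          | ObsNoise k \<Rightarrow> sets (vimage_algebra (space M) (r k) borel)) (sources K)"
    using realises by (simp add: realises_def sources_def)
  then show "indep_sets (\<lambda>s. {source_part \<alpha> \<beta> s -` B \<inter> space M |B. B \<in> sets borel}) (sources K)"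
  proof (rule indep_sets_mono_sets)
    have inner: "{(\<lambda>w. u \<bullet> f w) -` B \<inter> space M |B. B \<in> sets borel} \<subseteq> sets (vimage_algebra (space M) f borel)"
      for u :: "real^'q" and f :: "'w \<Rightarrow> real^'q"
    proof safe
      fix B :: "real set" assume B: "B \<in> sets borel"
      have [measurable]: "f \<in> vimage_algebra (space M) f borel \<rightarrow>\<^sub>M borel"
        by (rule measurable_vimage_algebra1) simp
      have "(\<lambda>w. u \<bullet> f w) \<in> vimage_algebra (space M) f borel \<rightarrow>\<^sub>M borel" by measurable
      from measurable_sets[OF this B]
      show "(\<lambda>w. u \<bullet> f w) -` B \<inter> space M \<in> sets (vimage_algebra (space M) f borel)" by simp
    qed
    fix s assume "s \<in> sources K"
    show "{source_part \<alpha> \<beta> s -` B \<inter> space M |B. B \<in> sets borel} \<subseteq> (case s of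
            Initial \<Rightarrow> sets (vimage_algebra (space M) (X 1) borel)
          | DynLin k \<Rightarrow> sets (vimage_algebra (space M) (om k) borel)
          | DynNoise k \<Rightarrow> sets (vimage_algebra (space M) (q k) borel)
          | ObsLin k \<Rightarrow> sets (vimage_algebra (space M) (ga k) borel)
          | ObsNoise k \<Rightarrow> sets (vimage_algebra (space M) (r k) borel))"
      by (cases s; simp only: source_part_def[abs_def] source.case inner)
  qed
qed

text \<open>Independence turns the characteristic function into a product over sources. The law of a
  noise functional is thus determined by \<open>\<mu>\<close> and \<open>noise_var\<close>, the
  quantities that the duality controls.\<close>

lemma char_noise_form:
  "(\<integral>w. iexp (noise_form K \<mu> \<alpha> \<beta> (state_noise w) (obs_noise w)) \<partial>M)
    = exp (\<i> * \<mu> - noise_var A K \<alpha> \<beta> / 2)"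
proof -
  define g where "g s = (case s of Initial \<Rightarrow> \<i> * (\<alpha> 0 \<bullet> am A) - (\<alpha> 0 \<bullet> (aP A *v \<alpha> 0)) / 2
     | DynLin k \<Rightarrow> - complex_of_real (\<alpha> k \<bullet> (aOmega A k *v \<alpha> k)) / 2
     | DynNoise k \<Rightarrow> - complex_of_real (\<alpha> k \<bullet> (aQ A k *v \<alpha> k)) / 2
     | ObsLin k \<Rightarrow> - complex_of_real (\<beta> k \<bullet> (aGamma A k *v \<beta> k)) / 2
     | ObsNoise k \<Rightarrow> - complex_of_real (\<beta> k \<bullet> (aR A k *v \<beta> k)) / 2)" for s
  have part: "(\<integral>w. iexp (source_part \<alpha> \<beta> s w) \<partial>M) = exp (g s)" if "s \<in> sources K" for s
    using that gaussian_rv_char[OF gaussian(1), of "\<alpha> 0"] gaussian_rv_char[OF gaussian(2)]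
      gaussian_rv_char[OF gaussian(3)] gaussian_rv_char[OF gaussian(4)] gaussian_rv_char[OF gaussian(5)]
    by (auto simp: sources_def source_part_def g_def)
  have "(\<integral>w. iexp (noise_form K \<mu> \<alpha> \<beta> (state_noise w) (obs_noise w)) \<partial>M)
    = (\<integral>w. iexp (\<mu> - \<alpha> 0 \<bullet> am A) * (\<Prod>s\<in>sources K. iexp (source_part \<alpha> \<beta> s w)) \<partial>M)"
    unfolding noise_form_source_parts of_real_add of_real_sum distrib_left exp_add sum_distrib_left
    by (simp add: exp_sum)
  also have "\<dots> = iexp (\<mu> - \<alpha> 0 \<bullet> am A) * (\<integral>w. (\<Prod>s\<in>sources K. iexp (source_part \<alpha> \<beta> s w)) \<partial>M)"
    by simp
  also have "(\<integral>w. (\<Prod>s\<in>sources K. iexp (source_part \<alpha> \<beta> s w)) \<partial>M)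
    = (\<Prod>s\<in>sources K. \<integral>w. iexp (source_part \<alpha> \<beta> s w) \<partial>M)"
  proof (rule indep_vars_lebesgue_integral)
    show "indep_vars (\<lambda>_. borel) (\<lambda>s w. iexp (source_part \<alpha> \<beta> s w)) (sources K)"
      by (rule indep_vars_compose2[OF indep_source_parts]) simp
    fix s assume "s \<in> sources K"
    then have "random_variable borel (source_part \<alpha> \<beta> s)" by (rule borel_measurable_source_part)
    then show "integrable M (\<lambda>w. iexp (source_part \<alpha> \<beta> s w))" by (intro integrable_iexp) auto
  qed simp
  also have "\<dots> = exp (\<Sum>s\<in>sources K. g s)"
    by (simp add: part exp_sum)
  also have "(\<Sum>s\<in>sources K. g s) = \<i> * (\<alpha> 0 \<bullet> am A) - noise_var A K \<alpha> \<beta> / 2"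
  proof -
    \<comment> \<open>The two process noises, each possibly singular, recombine here into their
      invertible total covariance.\<close>
    have "(\<Sum>k\<in>{1..<K}. \<alpha> k \<bullet> (state_cov A k *v \<alpha> k))
      = (\<Sum>k\<in>{1..<K}. \<alpha> k \<bullet> (aOmega A k *v \<alpha> k)) + (\<Sum>k\<in>{1..<K}. \<alpha> k \<bullet> (aQ A k *v \<alpha> k))"
      unfolding sum.distrib[symmetric]
      by (intro sum.cong) (auto simp: state_cov_def matrix_vector_mult_add_rdistrib inner_add_right)
    then show ?thesis
      unfolding noise_var_def lessThan_split_first[OF K] sum_sources g_def
      by (simp add: state_cov_def obs_cov_def matrix_vector_mult_add_rdistrib inner_add_right sum.distrib
          sum_negf sum_divide_distrib[symmetric] add_divide_distrib diff_divide_distrib)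
  qed
  finally show ?thesis
    by (simp add: exp_add[symmetric] algebra_simps)
qed

lemma integrable_source_part:
  assumes "s \<in> sources K"
  shows "integrable M (source_part \<alpha> \<beta> s)"
proof -
  note i = gaussian_rv_integrable[OF prob_space_axioms]
  show ?thesis
    using assms i[OF gaussian(1), of "\<alpha> 0"] i[OF gaussian(2)] i[OF gaussian(3)] i[OF gaussian(4)]
      i[OF gaussian(5)]
    unfolding source_part_def[abs_def] sources_def by auto
qed

lemma integrable_noise_affine:
  assumes "noise_affine K \<phi>"
  shows "integrable M (\<lambda>w. \<phi> (state_noise w) (obs_noise w))"
proof -
  obtain \<mu> \<alpha> \<beta> where \<phi>: "\<phi> = noise_form K \<mu> \<alpha> \<beta>"
    using assms unfolding noise_affine_def by blast
  show ?thesis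
    unfolding \<phi> noise_form_source_parts
    by (intro Bochner_Integration.integrable_add integrable_const Bochner_Integration.integrable_sum
        integrable_source_part)
qed

lemma error_orthogonal_cos:
  fixes u :: "real^'n"
  assumes k: "k \<in> {1..K}" and U: "U = (\<lambda>e v. g (measurements A e v))" and aff: "noise_affine K U"
  defines "D \<equiv> \<lambda>e v. u \<bullet> (trajectory A e k - rts_mean A K (measurements A e v) k)"
  shows "(\<integral>w. D (state_noise w) (obs_noise w) * cos (U (state_noise w) (obs_noise w)) \<partial>M) = 0"
proof -
  let ?D = "\<lambda>w. D (state_noise w) (obs_noise w)" and ?U = "\<lambda>w. U (state_noise w) (obs_noise w)"
  have D: "noise_affine K D"
    unfolding D_def inner_diff_right
    by (intro noise_affine_diff noise_affine_trajectory noise_affine_meas_affine meas_affine_rts_mean k)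
  have int: "integrable M ?D" "integrable M ?U" by (intro integrable_noise_affine D aff)+
  then have [measurable]: "?D \<in> borel_measurable M" "?U \<in> borel_measurable M" by auto
  \<comment> \<open>The imaginary parts of the two equal characteristic functions are the means of
    \<open>sin (U + s D)\<close> and \<open>sin (U - s D)\<close>, whose half difference is the mean
    of \<open>sin (s D) cos U\<close>.\<close>
  have sin0: "(\<integral>w. sin (s * ?D w) * cos (?U w) \<partial>M) = 0" for s
  proof -
    obtain \<mu> \<alpha> \<beta> \<alpha>' \<beta>' where f: "(\<lambda>e v. U e v + s * D e v) = noise_form K \<mu> \<alpha> \<beta>"
      "(\<lambda>e v. U e v - s * D e v) = noise_form K \<mu> \<alpha>' \<beta>'" "noise_var A K \<alpha> \<beta> = noise_var A K \<alpha>' \<beta>'"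
      unfolding D_def by (rule error_functional_symmetric[OF k U aff])
    have "(\<integral>w. iexp (?U w + s * ?D w) \<partial>M) = (\<integral>w. iexp (?U w - s * ?D w) \<partial>M)"
      using char_noise_form[of \<mu> \<alpha> \<beta>] char_noise_form[of \<mu> \<alpha>' \<beta>']
      unfolding f(3) f(1)[symmetric] f(2)[symmetric] by simp
    then have Im_eq: "Im (\<integral>w. iexp (?U w + s * ?D w) \<partial>M) = Im (\<integral>w. iexp (?U w - s * ?D w) \<partial>M)"
      by simp
    have im: "Im (\<integral>w. iexp (f w) \<partial>M) = (\<integral>w. sin (f w) \<partial>M)"
      if "f \<in> borel_measurable M" for f
    proof -
      have "integrable M (\<lambda>w. iexp (f w))" using that by (intro integrable_iexp) auto
      then have "Im (\<integral>w. iexp (f w) \<partial>M) = (\<integral>w. Im (iexp (f w)) \<partial>M)"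
        by (rule integral_Im[symmetric])
      then show ?thesis by (simp add: cis_conv_exp[symmetric])
    qed
    have m: "(\<lambda>w. ?U w + s * ?D w) \<in> borel_measurable M" "(\<lambda>w. ?U w - s * ?D w) \<in> borel_measurable M"
      by measurable
    have eq: "(\<integral>w. sin (?U w + s * ?D w) \<partial>M) = (\<integral>w. sin (?U w - s * ?D w) \<partial>M)"
      using Im_eq unfolding im[OF m(1)] im[OF m(2)] .
    have si: "integrable M (\<lambda>w. sin (f w))" if "f \<in> borel_measurable M" for f :: "'w \<Rightarrow> real"
      using that by (intro integrable_const_bound[of _ 1]) simp_all
    have "(\<integral>w. sin (s * ?D w) * cos (?U w) \<partial>M)
      = (\<integral>w. (sin (?U w + s * ?D w) - sin (?U w - s * ?D w)) / 2 \<partial>M)"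
      by (intro Bochner_Integration.integral_cong refl) (simp add: sin_add sin_diff)
    also have "\<dots> = ((\<integral>w. sin (?U w + s * ?D w) \<partial>M) - (\<integral>w. sin (?U w - s * ?D w) \<partial>M)) / 2"
      by (subst integral_divide_zero, subst Bochner_Integration.integral_diff) (auto intro!: si)
    finally show ?thesis using eq by simp
  qed
  \<comment> \<open>The limit is taken along \<open>s = 1 / (n + 1)\<close> after division by
    \<open>s\<close>; the bound \<open>abs (sin z) \<le> abs z\<close> makes \<open>abs D\<close> a
    dominating function.\<close>
  have lim: "((\<lambda>n. real (Suc n) * sin (inverse (real (Suc n)) * d)) \<longlonglongrightarrow> d)" for d :: real
  proof -
    have "((\<lambda>t. sin (t * d)) has_real_derivative d) (at 0)" by (auto intro!: derivative_eq_intros)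
    then have "((\<lambda>t. sin (t * d) / t) \<longlongrightarrow> d) (at 0)" by (simp add: has_field_derivative_iff)
    moreover have "filterlim (\<lambda>n. inverse (real (Suc n))) (at 0) sequentially"
      using LIMSEQ_inverse_real_of_nat by (auto simp: filterlim_at)
    ultimately have "(\<lambda>n. sin (inverse (real (Suc n)) * d) / inverse (real (Suc n))) \<longlonglongrightarrow> d"
      by (rule filterlim_compose)
    then show ?thesis by (simp add: divide_inverse mult.commute)
  qed
  have "(\<lambda>n. \<integral>w. real (Suc n) * sin (inverse (real (Suc n)) * ?D w) * cos (?U w) \<partial>M)
      \<longlonglongrightarrow> (\<integral>w. ?D w * cos (?U w) \<partial>M)"
  proof (rule integral_dominated_convergence[where w = "\<lambda>w. \<bar>?D w\<bar>"])
    show "AE w in M. (\<lambda>n. real (Suc n) * sin (inverse (real (Suc n)) * ?D w) * cos (?U w))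
        \<longlonglongrightarrow> ?D w * cos (?U w)"
      by (intro AE_I2 tendsto_mult lim tendsto_const)
    fix n
    have "norm (real (Suc n) * sin (inverse (real (Suc n)) * d) * cos a) \<le> \<bar>d\<bar>" for d a :: real
    proof -
      have "\<bar>sin (inverse (real (Suc n)) * d)\<bar> \<le> \<bar>inverse (real (Suc n)) * d\<bar>"
        by (rule abs_sin_x_le_abs_x)
      then have "real (Suc n) * \<bar>sin (inverse (real (Suc n)) * d)\<bar> \<le> real (Suc n) * \<bar>inverse (real (Suc n)) * d\<bar>"
        by (rule mult_left_mono) simp
      also have "\<dots> = \<bar>d\<bar>" by (simp add: abs_mult field_simps)
      finally have "real (Suc n) * \<bar>sin (inverse (real (Suc n)) * d)\<bar> * \<bar>cos a\<bar> \<le> \<bar>d\<bar> * 1"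
        by (intro mult_mono) auto
      then show ?thesis by (simp add: abs_mult)
    qed
    then show "AE w in M. norm (real (Suc n) * sin (inverse (real (Suc n)) * ?D w) * cos (?U w)) \<le> \<bar>?D w\<bar>"
      by blast
  qed (use int in auto)
  moreover have "(\<integral>w. real (Suc n) * sin (inverse (real (Suc n)) * ?D w) * cos (?U w) \<partial>M) = 0" for n
    unfolding mult.assoc by (simp only: integral_mult_right_zero sin0 mult_zero_right)
  ultimately show ?thesis by (simp only: LIMSEQ_const_iff)
qed

text \<open>\<open>realises\<close> prescribes the measurements only through pointwise equations on
  \<open>space M\<close>, so their measurability is inherited from the noises.\<close>

lemma borel_measurable_Y: "k \<in> {1..K} \<Longrightarrow> Y k \<in> borel_measurable M"
proof -
  assume k: "k \<in> {1..K}"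
  have "(\<lambda>w. Y k w \<bullet> b) \<in> borel_measurable M" for b
  proof -
    have "(\<lambda>w. b \<bullet> measurements A (state_noise w) (obs_noise w) k) \<in> borel_measurable M"
      using integrable_noise_affine[OF noise_affine_measurements[OF k]] by (rule borel_measurable_integrable)
    then show ?thesis
      by (rule measurable_cong[THEN iffD1, rotated]) (simp add: observed_measurements[OF _ k] inner_commute)
  qed
  then show ?thesis unfolding borel_measurable_euclidean_space[of "Y k"] by blast
qed

text \<open>Boxes in scalar coordinates generate the measurement algebra. The scalar form is what
  \<open>weighted_char_zero_family\<close> handles, one real coordinate at a time.\<close>

lemma sets_meas_algebra:
  "sets (meas_algebra K M Y) \<subseteq> sigma_sets (space M)
    {{w \<in> space M. \<forall>l\<in>{1..K} \<times> UNIV. Y (fst l) w $ snd l \<in> B l} | B. \<forall>l\<in>{1..K} \<times> UNIV. B l \<in> sets borel}"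
  (is "_ \<subseteq> sigma_sets _ ?G")
proof -
  let ?N = "sigma (space M) ?G"
  have G: "?G \<subseteq> Pow (space M)" by auto
  have space_N: "space ?N = space M" using G by (rule space_measure_of)
  have coord: "(\<lambda>w. Y k w $ i) \<in> borel_measurable ?N" if k: "k \<in> {1..K}" for k i
  proof (rule measurableI)
    fix B :: "real set" assume B: "B \<in> sets borel"
    \<comment> \<open>A condition on a single coordinate is a box whose other sides are
      \<open>UNIV\<close>.\<close>
    have "(\<forall>l\<in>{1..K} \<times> UNIV. Y (fst l) w $ snd l \<in> (if l = (k, i) then B else UNIV))
        \<longleftrightarrow> Y k w $ i \<in> B" (is "?A w \<longleftrightarrow> _") for w
    proof
      assume *: "?A w"
      from bspec[OF *, of "(k, i)"] k show "Y k w $ i \<in> B" by simp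
    qed auto
    then have "(\<lambda>w. Y k w $ i) -` B \<inter> space ?N
      = {w \<in> space M. \<forall>l\<in>{1..K} \<times> UNIV. Y (fst l) w $ snd l \<in> (if l = (k, i) then B else UNIV)}"
      unfolding space_N by (intro set_eqI) (simp only: vimage_eq Int_iff mem_Collect_eq conj_commute)
    also have "\<dots> \<in> ?G" using B by (intro CollectI exI[of _ "\<lambda>l. if l = (k, i) then B else UNIV"] conjI) auto
    finally show "(\<lambda>w. Y k w $ i) -` B \<inter> space ?N \<in> sets ?N"
      using G by (simp add: sets_measure_of sigma_sets.Basic)
  qed simp
  have "(\<lambda>w. \<lambda>k\<in>{1..K}. Y k w) \<in> ?N \<rightarrow>\<^sub>M (\<Pi>\<^sub>M k\<in>{1..K}. borel)"
  proof (rule measurable_restrict)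
    fix k assume k: "k \<in> {1..K}"
    show "Y k \<in> borel_measurable ?N"
      unfolding borel_measurable_euclidean_space[of "Y k"]
      using coord[OF k] by (auto simp: Basis_vec_def inner_axis)
  qed
  note meas = this
  have "sets (meas_algebra K M Y) \<subseteq> sets ?N"
    unfolding meas_algebra_def
  proof (rule sets_image_in_sets')
    show "space M \<in> sets ?N" using sets.top[of ?N] unfolding space_N .
    fix B :: "(nat \<Rightarrow> real^'m) set" assume "B \<in> sets (\<Pi>\<^sub>M k\<in>{1..K}. borel)"
    from measurable_sets[OF meas this]
    show "(\<lambda>w. \<lambda>k\<in>{1..K}. Y k w) -` B \<inter> space M \<in> sets ?N" unfolding space_N .
  qed
  then show ?thesis using G by (simp add: sets_measure_of)
qed

text \<open>The smoothed mean is measurable in the data and its error integrates to zero over every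
  event of the measurement algebra, which characterises the conditional expectation.\<close>

lemma posterior_mean_rts:
  assumes k: "k \<in> {1..K}"
  shows "posterior_mean_fun M (X k) K Y (\<lambda>y. rts_mean A K y k)"
  unfolding posterior_mean_fun_def
proof (intro conjI allI impI)
  let ?F = "meas_algebra K M Y"
  obtain c C where c: "\<And>y. rts_mean A K y k = c + (\<Sum>j\<in>{1..K}. C j *v y j)"
    using meas_affine_rts_mean[OF k] unfolding meas_affine_def by blast
  show "rts_mean A K y k = rts_mean A K y' k" if "\<forall>k\<in>{1..K}. y k = y' k" for y y'
    unfolding c using that by (intro arg_cong2[where f = "(+)"] sum.cong) auto
  show "continuous_on UNIV (\<lambda>y. rts_mean A K y k)"
    unfolding c
    by (intro continuous_intros bounded_linear.continuous_on[OF matrix_vector_mul_bounded_linear]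
        continuous_on_product_coordinates)
  fix i
  let ?e = "axis i 1 :: real^'n"
  have X_eq: "X k w $ i = ?e \<bullet> trajectory A (state_noise w) k" if "w \<in> space M" for w
    using state_trajectory[OF that k] by (simp add: inner_axis')
  have Y_eq: "rts_mean A K (\<lambda>k. Y k w) k = rts_mean A K (measurements A (state_noise w) (obs_noise w)) k"
    if "w \<in> space M" for w
    unfolding c using observed_measurements[OF that] by simp
  have int_X: "integrable M (\<lambda>w. X k w $ i)"
    using integrable_noise_affine[OF noise_affine_trajectory[OF k], of ?e A]
    by (rule Bochner_Integration.integrable_cong[THEN iffD1, rotated -1]) (simp_all add: X_eq)
  then show "integrable M (\<lambda>w. X k w $ i)" .
  have int_r: "integrable M (\<lambda>w. rts_mean A K (\<lambda>k. Y k w) k $ i)"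
    using integrable_noise_affine[OF noise_affine_meas_affine[OF meas_affine_rts_mean[OF k]], of ?e A A]
    by (rule Bochner_Integration.integrable_cong[THEN iffD1, rotated -1]) (simp_all add: Y_eq inner_axis')
  define D where "D w = X k w $ i - rts_mean A K (\<lambda>k. Y k w) k $ i" for w
  have int_D: "integrable M D" unfolding D_def by (intro Bochner_Integration.integrable_diff int_X int_r)
  have D_eq: "D w = ?e \<bullet> (trajectory A (state_noise w) k
      - rts_mean A K (measurements A (state_noise w) (obs_noise w)) k)" if "w \<in> space M" for w
    unfolding D_def Y_eq[OF that] X_eq[OF that] by (simp add: inner_diff_right inner_axis')
  let ?L = "{1..K} \<times> (UNIV :: 'm set)"
  \<comment> \<open>Every affine combination of scalar measurements is an admissible
    \<open>U\<close>, constant phase included, so orthogonality to cosines holds for the whole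
    family at once.\<close>
  have cos0: "(\<integral>w. D w * cos (\<theta> + (\<Sum>l\<in>?L. u l * Y (fst l) w $ snd l)) \<partial>M) = 0" for \<theta> u
  proof -
    define g where "g y = \<theta> + (\<Sum>l\<in>?L. u l * y (fst l) $ snd l)" for y :: "nat \<Rightarrow> real^'m"
    have Y_sum: "\<theta> + (\<Sum>l\<in>?L. u l * Y (fst l) w $ snd l)
        = g (measurements A (state_noise w) (obs_noise w))" if "w \<in> space M" for w
      unfolding g_def using observed_measurements[OF that]
      by (intro arg_cong2[where f = "(+)"] sum.cong) auto
    have "noise_affine K (\<lambda>e v. axis j 1 \<bullet> measurements A e v l)" if "l \<in> {1..K}" for j l
      using that by (rule noise_affine_measurements)
    then have aff: "noise_affine K (\<lambda>e v. g (measurements A e v))"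
      unfolding g_def
      by (intro noise_affine_add noise_affine_const noise_affine_sum noise_affine_scale) (auto simp: inner_axis')
    have "(\<integral>w. D w * cos (\<theta> + (\<Sum>l\<in>?L. u l * Y (fst l) w $ snd l)) \<partial>M)
      = (\<integral>w. ?e \<bullet> (trajectory A (state_noise w) k
        - rts_mean A K (measurements A (state_noise w) (obs_noise w)) k)
        * cos (g (measurements A (state_noise w) (obs_noise w))) \<partial>M)"
      by (intro Bochner_Integration.integral_cong refl) (simp only: D_eq Y_sum)
    then show ?thesis using error_orthogonal_cos[OF k refl aff, of ?e] by simp
  qed
  have meas_Z: "(\<lambda>w. Y (fst l) w $ snd l) \<in> borel_measurable M" if "l \<in> ?L" for l
  proof -
    have "Y (fst l) \<in> borel_measurable M" using that by (intro borel_measurable_Y) auto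
    moreover have "(\<lambda>v :: real^'m. v $ snd l) \<in> borel_measurable borel"
      by (intro borel_measurable_continuous_onI continuous_intros)
    ultimately show ?thesis by (rule measurable_compose)
  qed
  have zero: "(\<integral>w. D w * indicator E w \<partial>M) = 0" if "E \<in> sets ?F" for E
  proof (rule integral_zero_sigma_sets[where L = ?L and Z = "\<lambda>l w. Y (fst l) w $ snd l"])
    show "E \<in> sigma_sets (space M) {{w \<in> space M. \<forall>l\<in>?L. Y (fst l) w $ snd l \<in> B l} |B.
        \<forall>l\<in>?L. B l \<in> sets borel}"
      by (rule subsetD[OF sets_meas_algebra that])
    show "(\<integral>w. D w * (\<Prod>l\<in>?L. indicator (B l) (Y (fst l) w $ snd l)) \<partial>M) = 0"
      if "\<And>l. l \<in> ?L \<Longrightarrow> B l \<in> sets borel" for B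
      by (rule weighted_char_zero_family[OF _ int_D meas_Z cos0 that]) auto
  qed (use int_D meas_Z in auto)
  have Y_F: "Y j \<in> borel_measurable ?F" if "j \<in> {1..K}" for j
  proof -
    have "(\<lambda>w. \<lambda>k\<in>{1..K}. Y k w) \<in> ?F \<rightarrow>\<^sub>M (\<Pi>\<^sub>M k\<in>{1..K}. borel)"
      unfolding meas_algebra_def by (rule measurable_vimage_algebra1) (auto simp: space_PiM)
    from measurable_compose[OF this measurable_component_singleton[OF that]] that show ?thesis by simp
  qed
  have sub: "subalgebra M ?F"
    unfolding subalgebra_def
  proof
    show "space ?F = space M" by (simp add: meas_algebra_def)
    have "(\<lambda>w. \<lambda>k\<in>{1..K}. Y k w) \<in> M \<rightarrow>\<^sub>M (\<Pi>\<^sub>M k\<in>{1..K}. borel)"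
      by (intro measurable_restrict borel_measurable_Y)
    then show "sets ?F \<subseteq> sets M"
      unfolding meas_algebra_def by (intro sets_image_in_sets') (auto dest: measurable_sets)
  qed
  interpret F: finite_measure_subalgebra M ?F by unfold_locales (rule sub)
  show "AE w in M. real_cond_exp M ?F (\<lambda>w. X k w $ i) w = rts_mean A K (\<lambda>k. Y k w) k $ i"
  proof (rule F.real_cond_exp_charact[OF _ int_X int_r])
    show "(\<lambda>w. rts_mean A K (\<lambda>k. Y k w) k $ i) \<in> borel_measurable ?F"
    proof -
      have "(\<lambda>w. rts_mean A K (\<lambda>k. Y k w) k) \<in> borel_measurable ?F"
        unfolding c
        by (intro borel_measurable_add borel_measurable_const borel_measurable_sum
            borel_measurable_matrix_vector Y_F)
      moreover have "(\<lambda>v :: real^'n. v $ i) \<in> borel_measurable borel"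
        by (intro borel_measurable_continuous_onI continuous_intros)
      ultimately show ?thesis by (rule measurable_compose)
    qed
    fix E assume E: "E \<in> sets ?F"
    then have EM: "E \<in> sets M" using sub by (auto simp: subalgebra_def)
    have "(\<integral>w. X k w $ i * indicator E w \<partial>M) - (\<integral>w. rts_mean A K (\<lambda>k. Y k w) k $ i * indicator E w \<partial>M)
      = (\<integral>w. X k w $ i * indicator E w - rts_mean A K (\<lambda>k. Y k w) k $ i * indicator E w \<partial>M)"
      using integrable_real_mult_indicator[OF EM int_X] integrable_real_mult_indicator[OF EM int_r]
      by (intro Bochner_Integration.integral_diff[symmetric])
    also have "\<dots> = (\<integral>w. D w * indicator E w \<partial>M)" by (simp add: D_def left_diff_distrib)
    finally show "(\<integral>w\<in>E. X k w $ i \<partial>M) = (\<integral>w\<in>E. rts_mean A K (\<lambda>k. Y k w) k $ i \<partial>M)"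
      using zero[OF E] by (simp add: set_lebesgue_integral_def mult.commute)
  qed
qed

end

theorem proposition4p2:
  fixes md :: "('n::finite, 'm::finite) ssm"
    and K :: nat
    and xh :: "nat \<Rightarrow> real^'n"
    and P :: "nat \<Rightarrow> real^'n^'n"
    and y :: "nat \<Rightarrow> real^'m"
    and S :: "('n, 'm) ridx \<Rightarrow> ('n, 'm) ridx \<Rightarrow> real"
  assumes "1 \<le> K"
    and "spd (prior_cov md)"
    and "\<forall>k\<in>{1..K}. spd (P k)"
    and "\<forall>k\<in>{1..<K}. slr_moments_finite (dyn md k) (P k)"
    and "\<forall>k\<in>{1..K}. slr_moments_finite (obs md k) (P k)"
    and "\<forall>k\<in>{1..<K}. spd (Qcov md k + Omega_at md xh P k)"
    and "\<forall>k\<in>{1..K}. spd (Rcov md k + Gamma_at md xh P k)"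
    and "is_Sigma_inv_sqrt md K xh P S"
  shows
    "(\<forall>x. L_IPLS md K xh P y x = 1/2 * sq_norm_on (res_index K) (residual md K P y S x)) \<and>
     (\<forall>x. is_gn_iterate md K xh P y S x \<longleftrightarrow>
        (\<forall>k\<in>{1..K}. x k = rts_mean (slr_affine_model md xh P) K y k)) \<and>
     (\<forall>(M :: 'w measure) X Y om q ga r.
        realises (slr_affine_model md xh P) K M X Y om q ga r \<longrightarrow>
        (\<forall>k\<in>{1..K}. posterior_mean_fun M (X k) K Y
           (\<lambda>y'. rts_mean (slr_affine_model md xh P) K y' k)))"
proof -
  let ?A = "slr_affine_model md xh P"
  interpret regular_affine_model ?A K
    using assms(1,2,6,7) by unfold_locales (simp_all add: slr_affine_model_def)
  have gn: "gn_objective md K xh P y S x = 1/2 * affine_cost ?A K y x" for x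
    by (rule gn_objective_affine_cost) (use assms in auto)
  have post: "posterior_mean_fun M (X k) K Y (\<lambda>y'. rts_mean ?A K y' k)"
    if r: "realises ?A K M X Y om q ga r" and k: "k \<in> {1..K}" for M :: "'w measure" and X Y om q ga r k
  proof -
    \<comment> \<open>\<open>realised_affine_model\<close> has \<open>prob_space\<close> as a
      parent, so this part is supplied first, from the realisation itself.\<close>
    interpret prob_space M by (rule realised_prob_space[OF r])
    interpret realised_affine_model ?A K M X Y om q ga r by unfold_locales (rule r)
    show ?thesis by (rule posterior_mean_rts[OF k])
  qed
  show ?thesis
    using L_IPLS_residual[OF assms(8)] affine_cost_minimiser_iff post
    unfolding is_gn_iterate_def gn by simp
qed

end
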